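(* Super-activation occurs for arbitrarily varying classical-quantum wiretap channels; that is, there exist two arbitrarily varying classical-quantum wiretap channels $\{(W_t,V_t): t\in\theta\}$ and $\{(W'_{t'},V'_{t'}): t'\in\theta'\}$ with $$C_s(\{(W_t,V_t): t\in\theta\})=0\quad\text{and}\quad C_s(\{(W'_{t'},V'_{t'}): t'\in\theta'\})=0$$ such that the deterministic secrecy capacity of their product is positive: $$C_s\bigl(\{(W_{t}\otimes W'_{t'},\,V_{t}\otimes V'_{t'}): (t,t')\in\theta\times\theta'\}\bigr)>0.$$
   Context: Notation. All logarithms are to base 2. For a finite set $\mathbf{A}$, $P(\mathbf{A})$ is the set of probability distributions on $\mathbf{A}$. For a finite-dimensional complex Hilbert space $H$, $\mathcal{S}(H)$ is the set of density operators on $H$. A classical-quantum channel is a linear (i.e. convex-combination preserving) map $W:P(\mathbf{A})\to\mathcal{S}(H)$; $W(a)$ denotes the value at the point mass at $a\in\mathbf{A}$, so $W(P)=\sum_a P(a)W(a)$. For a family $\{W_t:t\in\theta\}$ of such channels and $t^n=(t_1,\ldots,t_n)\in\theta^n$, $W_{t^n}:P(\mathbf{A}^n)\to\mathcal{S}(H^{\otimes n})$ is the linear map with $W_{t^n}(a^n)=W_{t_1}(a_1)\otimes\cdots\otimes W_{t_n}(a_n)$ for $a^n=(a_1,\ldots,a_n)\in\mathbf{A}^n$; similarly $V_{t^n}$. von Neumann entropy: $S(\rho)=-\mathrm{tr}(\rho\log\rho)$. For a finite set of states $\Phi=\{\rho_x:x\in\mathbf{B}\}$ labeled by $\mathbf{B}$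 and $Q\in P(\mathbf{B})$, the Holevo quantity is $\chi(Q;\Phi)=S\bigl(\sum_x Q(x)\rho_x\bigr)-\sum_x Q(x)S(\rho_x)$. An arbitrarily varying classical-quantum wiretap channel is a set of pairs $\{(W_t,V_t):t\in\theta\}$, indexed by a finite set $\theta$, of classical-quantum channels $W_t:P(\mathbf{A})\to\mathcal{S}(H)$ (to the legitimate receiver) and $V_t:P(\mathbf{A})\to\mathcal{S}(H')$ (to the wiretapper), with $\mathbf{A}$ a finite set and $H,H'$ finite-dimensional complex Hilbert spaces. Product. If $\{(W_t,V_t):t\in\theta\}$ has input alphabet $\mathbf{A}$ and $\{(W'_{t'},V'_{t'}):t'\in\theta'\}$ has input alphabet $\mathbf{A}'$, their product is the arbitrarily varying classical-quantum wiretap channel with state set $\theta\times\theta'$ and input alphabet $\mathbf{A}\times\mathbf{A}'$ given by $(a,a')\mapsto W_t(a)\otimes W'_{t'}(a')$ for the legitimate receiver and $(a,a')\mapsto V_t(a)\otimes V'_{t'}(a')$ for the wiretapper when the state is $(t,t')$. Codes. For positive integers $n,J_n$, an $(n,J_n)$ (deterministic) code $\mathcal{C}=(E,\{D_j:j=1,\ldots,J_n\})$ for $\{(W_t,V_t):t\in\theta\}$ consists of a stochastic encoder $E:\{1,\ldots,J_n\}\to P(\mathbf{A}^n)$, $j\mapsto E(\cdot|j)$, and positive semi-definite operators $D_1,\ldots,D_{J_n}$ on $H^{\otimes n}$ with $\sum_{j}D_j=\mathrm{id}_{H^{\otimes n}}$. For $t^n\in\theta^n$ put $$P_e(\mathcal{C},t^n)=1-\frac1{J_n}\sum_{j=1}^{J_n}\mathrm{tr}\bigl(W_{t^n}(E(\cdot|j))D_j\bigr),\qquad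 Z_{t^n}=\{V_{t^n}(E(\cdot|j)):j\in\{1,\ldots,J_n\}\}.$$ $R_{\mathrm{uni}}$ is the uniform distribution on $\{1,\ldots,J_n\}$. Deterministic secrecy capacity. $R\ge0$ is an achievable (deterministic) secrecy rate if for every $\epsilon,\delta,\zeta>0$ and all sufficiently large $n$ there is an $(n,J_n)$ code $\mathcal{C}$ with $\frac{\log J_n}{n}>R-\delta$, $\max_{t^n\in\theta^n}P_e(\mathcal{C},t^n)<\epsilon$ and $\max_{t^n\in\theta^n}\chi(R_{\mathrm{uni}};Z_{t^n})<\zeta$. $C_s(\{(W_t,V_t):t\in\theta\})$ is the supremum of all achievable (deterministic) secrecy rates. *)

theory Defs
  imports
    "Jordan_Normal_Form.Schur_Decomposition"
    "HOL-Probability.Probability_Mass_Function"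
    "HOL-Library.Extended_Real"
begin

text \<open>
  A finite-dimensional Hilbert space is \<open>\<complex>\<^sup>d\<close>, and operators on it are the matrices in
  \<open>carrier_mat d d\<close>.
\<close>

definition mat_trace :: "complex mat \<Rightarrow> complex" where
  "mat_trace A = (\<Sum>i<dim_row A. A $$ (i, i))"

text \<open>
  The order is the one on \<open>complex\<close> in which \<open>0 \<le> z\<close> means that \<open>z\<close> is real and nonnegative,
  so a positive semi-definite matrix is in particular Hermitian.
\<close>

definition pos_semidef :: "nat \<Rightarrow> complex mat \<Rightarrow> bool" where
  "pos_semidef d A \<longleftrightarrow>
     A \<in> carrier_mat d d \<and> (\<forall>v \<in> carrier_vec d. 0 \<le> (A *\<^sub>v v) \<bullet>c v)"

definition density_operators :: "nat \<Rightarrow> complex mat set" where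
  "density_operators d = {\<rho>. pos_semidef d \<rho> \<and> mat_trace \<rho> = 1}"

definition kron :: "complex mat \<Rightarrow> complex mat \<Rightarrow> complex mat" (infixr \<open>\<otimes>\<^sub>K\<close> 75) where
  "A \<otimes>\<^sub>K B = Matrix.mat (dim_row A * dim_row B) (dim_col A * dim_col B)
     (\<lambda>(i, j). A $$ (i div dim_row B, j div dim_col B) * B $$ (i mod dim_row B, j mod dim_col B))"

definition kron_list :: "complex mat list \<Rightarrow> complex mat" where
  "kron_list As = foldr kron As (1\<^sub>m 1)"

definition mat_sum :: "nat \<Rightarrow> ('x \<Rightarrow> complex mat) \<Rightarrow> 'x set \<Rightarrow> complex mat" where
  "mat_sum d \<rho> B = Matrix.mat d d (\<lambda>ij. \<Sum>x\<in>B. \<rho> x $$ ij)"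

text \<open>The average \<open>\<Sum>x\<in>B. Q(x) \<rho>(x)\<close>, which is also the value \<open>W(Q)\<close> of a channel \<open>W\<close>.\<close>

definition mixture :: "nat \<Rightarrow> 'x set \<Rightarrow> ('x \<Rightarrow> complex mat) \<Rightarrow> 'x pmf \<Rightarrow> complex mat" where
  "mixture d B \<rho> Q = mat_sum d (\<lambda>x. complex_of_real (pmf Q x) \<cdot>\<^sub>m \<rho> x) B"

text \<open>
  \<open>f(A)\<close> for a Hermitian matrix \<open>A\<close>: if \<open>A = U diag(\<lambda>) U\<^sup>*\<close> with \<open>U\<close> unitary, then
  \<open>f(A) = U diag(f \<circ> \<lambda>) U\<^sup>*\<close>. The result does not depend on the diagonalisation that is chosen.
\<close>

definition hermitian_fun :: "(real \<Rightarrow> real) \<Rightarrow> complex mat \<Rightarrow> complex mat" where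
  "hermitian_fun f A = (let n = dim_row A in
     SOME B. \<exists>U l. U \<in> carrier_mat n n \<and> mat_adjoint U * U = 1\<^sub>m n \<and>
       A = U * mat_diag n (\<lambda>i. complex_of_real (l i)) * mat_adjoint U \<and>
       B = U * mat_diag n (\<lambda>i. complex_of_real (f (l i))) * mat_adjoint U)"

text \<open>
  \<open>- tr (\<rho> log \<rho>)\<close>. A zero eigenvalue of \<open>\<rho>\<close> contributes \<open>0 * log 2 0 = 0\<close>, the usual convention.
\<close>

definition vn_entropy :: "complex mat \<Rightarrow> real" where
  "vn_entropy \<rho> = - Re (mat_trace (\<rho> * hermitian_fun (log 2) \<rho>))"

definition holevo :: "nat \<Rightarrow> 'x set \<Rightarrow> 'x pmf \<Rightarrow> ('x \<Rightarrow> complex mat) \<Rightarrow> real" where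
  "holevo d B Q \<rho> = vn_entropy (mixture d B \<rho> Q) - (\<Sum>x\<in>B. pmf Q x * vn_entropy (\<rho> x))"

text \<open>
  A classical-quantum channel is given by its values on the point masses; its value on a
  distribution is a \<^const>\<open>mixture\<close>.
\<close>

definition cq_channel :: "'a set \<Rightarrow> nat \<Rightarrow> ('a \<Rightarrow> complex mat) \<Rightarrow> bool" where
  "cq_channel A d W \<longleftrightarrow> (\<forall>a\<in>A. W a \<in> density_operators d)"

record ('t, 'a) avcqwc =
  states :: "'t set"
  alphabet :: "'a set"
  dim_rcv :: nat
  rcv :: "'t \<Rightarrow> 'a \<Rightarrow> complex mat"
  dim_tap :: nat
  tap :: "'t \<Rightarrow> 'a \<Rightarrow> complex mat"

definition is_avcqwc :: "('t, 'a) avcqwc \<Rightarrow> bool" where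
  "is_avcqwc C \<longleftrightarrow>
     finite (states C) \<and> states C \<noteq> {} \<and> finite (alphabet C) \<and> alphabet C \<noteq> {} \<and>
     (\<forall>t \<in> states C. cq_channel (alphabet C) (dim_rcv C) (rcv C t) \<and>
                     cq_channel (alphabet C) (dim_tap C) (tap C t))"

definition avcqwc_prod ::
    "('t, 'a) avcqwc \<Rightarrow> ('u, 'b) avcqwc \<Rightarrow> ('t \<times> 'u, 'a \<times> 'b) avcqwc" where
  "avcqwc_prod C C' =
     \<lparr> states = states C \<times> states C',
       alphabet = alphabet C \<times> alphabet C',
       dim_rcv = dim_rcv C * dim_rcv C',
       rcv = (\<lambda>(t, t') (a, a'). rcv C t a \<otimes>\<^sub>K rcv C' t' a'),
       dim_tap = dim_tap C * dim_tap C',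
       tap = (\<lambda>(t, t') (a, a'). tap C t a \<otimes>\<^sub>K tap C' t' a') \<rparr>"

definition words :: "nat \<Rightarrow> 'x set \<Rightarrow> 'x list set" where
  "words n A = {xs. length xs = n \<and> set xs \<subseteq> A}"

definition rcv_out :: "('t, 'a) avcqwc \<Rightarrow> 't list \<Rightarrow> 'a list pmf \<Rightarrow> complex mat" where
  "rcv_out C ts P = mixture (dim_rcv C ^ length ts) (words (length ts) (alphabet C))
     (\<lambda>as. kron_list (map2 (rcv C) ts as)) P"

definition tap_out :: "('t, 'a) avcqwc \<Rightarrow> 't list \<Rightarrow> 'a list pmf \<Rightarrow> complex mat" where
  "tap_out C ts P = mixture (dim_tap C ^ length ts) (words (length ts) (alphabet C))
     (\<lambda>as. kron_list (map2 (tap C) ts as)) P"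

text \<open>An \<open>(n, J)\<close> code with encoder \<open>E\<close> and decoding operators \<open>D\<close>, both indexed by \<open>{1..J}\<close>.\<close>

definition is_code ::
    "('t, 'a) avcqwc \<Rightarrow> nat \<Rightarrow> nat \<Rightarrow> (nat \<Rightarrow> 'a list pmf) \<Rightarrow> (nat \<Rightarrow> complex mat) \<Rightarrow> bool" where
  "is_code C n J E D \<longleftrightarrow>
     0 < n \<and> 0 < J \<and>
     (\<forall>j\<in>{1..J}. set_pmf (E j) \<subseteq> words n (alphabet C) \<and> pos_semidef (dim_rcv C ^ n) (D j)) \<and>
     mat_sum (dim_rcv C ^ n) D {1..J} = 1\<^sub>m (dim_rcv C ^ n)"

definition error_prob ::
    "('t, 'a) avcqwc \<Rightarrow> nat \<Rightarrow> (nat \<Rightarrow> 'a list pmf) \<Rightarrow> (nat \<Rightarrow> complex mat) \<Rightarrow> 't list \<Rightarrow> real" where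
  "error_prob C J E D ts =
     1 - (1 / real J) * (\<Sum>j=1..J. Re (mat_trace (rcv_out C ts (E j) * D j)))"

definition leakage ::
    "('t, 'a) avcqwc \<Rightarrow> nat \<Rightarrow> (nat \<Rightarrow> 'a list pmf) \<Rightarrow> 't list \<Rightarrow> real" where
  "leakage C J E ts =
     holevo (dim_tap C ^ length ts) {1..J} (pmf_of_set {1..J}) (\<lambda>j. tap_out C ts (E j))"

definition achievable_secrecy_rate :: "('t, 'a) avcqwc \<Rightarrow> real \<Rightarrow> bool" where
  "achievable_secrecy_rate C R \<longleftrightarrow> 0 \<le> R \<and>
     (\<forall>\<epsilon>>0. \<forall>\<delta>>0. \<forall>\<zeta>>0. \<forall>\<^sub>F n in sequentially.
        \<exists>J E D. is_code C n J E D \<and>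
          log 2 (real J) / real n > R - \<delta> \<and>
          (MAX ts \<in> words n (states C). error_prob C J E D ts) < \<epsilon> \<and>
          (MAX ts \<in> words n (states C). leakage C J E ts) < \<zeta>)"

definition secrecy_capacity :: "('t, 'a) avcqwc \<Rightarrow> ereal" where
  "secrecy_capacity C = Sup (ereal ` {R. achievable_secrecy_rate C R})"

end

theory Submission
  imports Defs
begin

text \<open>
  Both channels are classical. The first outputs \<open>t + a\<close> for bits \<open>t\<close> (state) and \<open>a\<close> (input) and
  shows nothing to the wiretapper. It is symmetrizable: a jammer who sends a codeword of a random
  message makes the two messages indistinguishable, so no code with two messages is reliable. The
  second channel is a noiseless bit that the wiretapper sees as well, so every reliable code leaks.

  In the product, the second channel carries a uniformly random key \<open>k\<close> and the first one carries
  \<open>x XOR k\<close>. The receiver obtains the symbol \<open>x\<close> unless \<open>x XOR k \<noteq> t\<close>. For every fixed state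
  sequence this is an erasure channel with independent erasures of probability 1/2, hence a
  positive rate is achievable, and the wiretapper only sees the key.
\<close>

subsection \<open>Classical channels as diagonal matrices\<close>

text \<open>The classical symbol \<open>i < d\<close> as a pure state; distinct symbols are
  orthogonal, hence perfectly distinguishable.\<close>

definition basis_proj :: "nat \<Rightarrow> nat \<Rightarrow> complex mat" where
  "basis_proj d i = mat_diag d (\<lambda>j. if j = i then 1 else 0)"

text \<open>\<open>kron\<close> puts the pair \<open>(i, j)\<close> at position
  \<open>i * d' + j\<close>. A basis vector of the tensor power therefore sits at the number whose
  base \<open>d\<close> digits are the output word, most significant first.\<close>

fun radix :: "nat \<Rightarrow> nat list \<Rightarrow> nat" where
  "radix d [] = 0"
| "radix d (y # ys) = y * d ^ length ys + radix d ys"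

lemma radix_less: "set ys \<subseteq> {..<d} \<Longrightarrow> radix d ys < d ^ length ys"
proof (induction ys)
  case (Cons y ys)
  then have "radix d ys < d ^ length ys" "Suc y \<le> d" by auto
  then have "y * d ^ length ys + radix d ys < Suc y * d ^ length ys" by simp
  also have "\<dots> \<le> d * d ^ length ys" using \<open>Suc y \<le> d\<close> by (rule mult_right_mono) simp
  finally show ?case by simp
qed simp

lemma radix_inj:
  assumes "length xs = length ys" "set xs \<subseteq> {..<d}" "set ys \<subseteq> {..<d}" "radix d xs = radix d ys"
  shows "xs = ys"
  using assms
proof (induction xs ys rule: list_induct2)
  case (Cons x xs y ys)
  have b: "radix d xs < d ^ length xs" "radix d ys < d ^ length xs"
    using Cons radix_less[of xs d] radix_less[of ys d] by auto
  then have nz: "d ^ length xs \<noteq> 0" by (metis not_less0)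
  have e: "x * d ^ length xs + radix d xs = y * d ^ length xs + radix d ys"
    using Cons by simp
  have "(x * d ^ length xs + radix d xs) div d ^ length xs = x" using b nz by simp
  moreover have "(y * d ^ length xs + radix d ys) div d ^ length xs = y" using b nz by simp
  ultimately have "x = y" using e by simp
  then show ?case using Cons e by simp
qed simp

lemma kron_basis_proj:
  assumes "i < d" "j < d'"
  shows "basis_proj d i \<otimes>\<^sub>K basis_proj d' j = basis_proj (d * d') (i * d' + j)"
proof (rule eq_matI)
  fix r c assume rc: "r < dim_row (basis_proj (d * d') (i * d' + j))"
    "c < dim_col (basis_proj (d * d') (i * d' + j))"
  then have rc: "r < d * d'" "c < d * d'" by (auto simp: basis_proj_def mat_diag_def)
  have d': "d' > 0" using assms by simp
  have lt: "r div d' < d" "c div d' < d" "r mod d' < d'" "c mod d' < d'"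
    using rc d' by (auto simp: less_mult_imp_div_less)
  have s: "r div d' = i \<and> r mod d' = j \<longleftrightarrow> r = i * d' + j" for r
    using assms div_mult_mod_eq[of r d'] by auto
  have t: "r div d' = c div d' \<and> r mod d' = c mod d' \<longleftrightarrow> r = c"
    by (metis div_mult_mod_eq)
  show "(basis_proj d i \<otimes>\<^sub>K basis_proj d' j) $$ (r, c) = basis_proj (d * d') (i * d' + j) $$ (r, c)"
    using rc lt s[of c] t by (auto simp: kron_def basis_proj_def mat_diag_def)
qed (auto simp: kron_def basis_proj_def mat_diag_def)

lemma kron_list_basis_proj:
  assumes "length ts = length as"
    "\<And>t a. (t, a) \<in> set (zip ts as) \<Longrightarrow> W t a = basis_proj d (y t a) \<and> y t a < d"
  shows "kron_list (map2 W ts as) = basis_proj (d ^ length ts) (radix d (map2 y ts as))"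
    (is "?P ts as")
  using assms
proof (induction ts as rule: list_induct2)
  case Nil
  show ?case by (auto simp: kron_list_def basis_proj_def mat_diag_def)
next
  case (Cons t ts a as)
  have IH: "?P ts as" using Cons by auto
  have W: "W t a = basis_proj d (y t a)" "y t a < d" using Cons by auto
  have "set (map2 y ts as) \<subseteq> {..<d}" using Cons.prems by auto
  from radix_less[OF this] Cons have "radix d (map2 y ts as) < d ^ length ts" by simp
  then show ?case using IH W Cons.hyps by (simp add: kron_list_def kron_basis_proj)
qed

lemma mixture_cong:
  assumes "B = B'" "\<And>x. x \<in> B' \<Longrightarrow> \<rho> x = \<sigma> x" shows "mixture d B \<rho> P = mixture d B' \<sigma> P"
  using assms unfolding mixture_def mat_sum_def by (auto cong: sum.cong)

text \<open>The diagonal is the image under \<open>e\<close> of \<open>P\<close> restricted to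
  \<open>B\<close>, which turns channel outputs into classical distributions.\<close>

lemma mixture_basis_proj:
  "mixture d B (\<lambda>x. basis_proj d (e x)) P =
   mat_diag d (\<lambda>i. complex_of_real (\<Sum>x\<in>B. pmf P x * of_bool (e x = i)))"
  by (rule eq_matI) (auto simp: mixture_def mat_sum_def basis_proj_def mat_diag_def of_bool_def
      intro!: sum.cong sum.neutral)

lemma mat_trace_mat_diag_mult:
  assumes "D \<in> carrier_mat d d"
  shows "mat_trace (mat_diag d f * D) = (\<Sum>i<d. f i * D $$ (i, i))"
  using assms by (simp add: mat_trace_def mat_diag_mult_left)

text \<open>A diagonal state meets only the diagonal of \<open>D\<close>, so coherences in a quantum
  measurement cannot help the decoder.\<close>

lemma success_basis_proj:
  assumes "D \<in> carrier_mat d d" "finite B" "\<And>x. x \<in> B \<Longrightarrow> e x < d"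
  shows "Re (mat_trace (mixture d B (\<lambda>x. basis_proj d (e x)) P * D)) =
    (\<Sum>x\<in>B. pmf P x * Re (D $$ (e x, e x)))"
proof -
  have "Re (mat_trace (mixture d B (\<lambda>x. basis_proj d (e x)) P * D)) =
     (\<Sum>i<d. (\<Sum>x\<in>B. pmf P x * of_bool (e x = i)) * Re (D $$ (i, i)))"
    using assms by (simp add: mixture_basis_proj mat_trace_mat_diag_mult flip: of_real_sum)
  also have "\<dots> = (\<Sum>x\<in>B. \<Sum>i<d. if e x = i then pmf P x * Re (D $$ (i, i)) else 0)"
    by (subst sum.swap) (auto simp: sum_distrib_right intro!: sum.cong)
  also have "\<dots> = (\<Sum>x\<in>B. pmf P x * Re (D $$ (e x, e x)))"
    using assms by (intro sum.cong) auto
  finally show ?thesis .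
qed

lemma mat_diag_mult_vec:
  assumes "v \<in> carrier_vec d"
  shows "mat_diag d f *\<^sub>v v = Matrix.vec d (\<lambda>i. f i * v $ i)"
proof (rule eq_vecI)
  fix i assume "i < dim_vec (Matrix.vec d (\<lambda>i. f i * v $ i))"
  then have i: "i < d" by simp
  have "(mat_diag d f *\<^sub>v v) $ i = (\<Sum>j = 0..<d. (if i = j then f j else 0) * v $ j)"
    using i assms by (auto simp: mat_diag_def scalar_prod_def intro!: sum.cong)
  also have "\<dots> = (\<Sum>j = 0..<d. if i = j then f j * v $ j else 0)"
    by (intro sum.cong) auto
  finally show "(mat_diag d f *\<^sub>v v) $ i = Matrix.vec d (\<lambda>i. f i * v $ i) $ i"
    using i by simp
qed (simp add: mat_diag_def)

lemma pos_semidef_mat_diag: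
  assumes "\<And>i. i < d \<Longrightarrow> 0 \<le> f i"
  shows "pos_semidef d (mat_diag d f)"
  unfolding pos_semidef_def
proof (intro conjI ballI)
  fix v :: "complex Matrix.vec" assume v: "v \<in> carrier_vec d"
  have "(mat_diag d f *\<^sub>v v) \<bullet>c v = (\<Sum>i = 0..<d. f i * (v $ i * cnj (v $ i)))"
    using v by (auto simp: mat_diag_mult_vec scalar_prod_def conjugate_complex_def mult.assoc
        intro!: sum.cong)
  also have "\<dots> \<ge> 0"
  proof (rule sum_nonneg)
    fix i assume "i \<in> {0..<d}"
    then have "0 \<le> f i" using assms by simp
    moreover have "0 \<le> v $ i * cnj (v $ i)" by (simp add: less_eq_complex_def)
    ultimately show "0 \<le> f i * (v $ i * cnj (v $ i))" by (rule mult_nonneg_nonneg)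
  qed
  finally show "0 \<le> (mat_diag d f *\<^sub>v v) \<bullet>c v" .
qed (simp add: mat_diag_def)

lemma pos_semidef_diag_nonneg:
  assumes "pos_semidef d D" "i < d" shows "0 \<le> Re (D $$ (i, i))"
proof -
  have D: "D \<in> carrier_mat d d" using assms by (simp add: pos_semidef_def)
  have "0 \<le> (D *\<^sub>v unit_vec d i) \<bullet>c unit_vec d i"
    using assms unfolding pos_semidef_def by (simp add: unit_vec_carrier)
  also have "(D *\<^sub>v unit_vec d i) \<bullet>c unit_vec d i = D $$ (i, i)"
  proof -
    have "conjugate (unit_vec d i :: complex Matrix.vec) = unit_vec d i"
      by (rule eq_vecI) (auto simp: unit_vec_def)
    then show ?thesis using D assms(2) by simp
  qed
  finally show ?thesis by (simp add: less_eq_complex_def)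
qed

lemma basis_proj_density:
  assumes "i < d" shows "basis_proj d i \<in> density_operators d"
proof -
  have "pos_semidef d (basis_proj d i)"
    unfolding basis_proj_def by (rule pos_semidef_mat_diag) (auto simp: less_eq_complex_def)
  moreover have "mat_trace (basis_proj d i) = 1"
    using assms by (simp add: mat_trace_def basis_proj_def mat_diag_def)
  ultimately show ?thesis by (simp add: density_operators_def)
qed

section \<open>Entropy and Holevo quantity of diagonal states\<close>

lemma hermitian_fun_mat_diag:
  "hermitian_fun f (mat_diag n (\<lambda>i. complex_of_real (a i))) =
   mat_diag n (\<lambda>i. complex_of_real (f (a i)))" (is "hermitian_fun f ?A = ?R")
proof -
  let ?Q = "\<lambda>B. \<exists>U l. U \<in> carrier_mat n n \<and> mat_adjoint U * U = 1\<^sub>m n \<and>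
       ?A = U * mat_diag n (\<lambda>i. complex_of_real (l i)) * mat_adjoint U \<and>
       B = U * mat_diag n (\<lambda>i. complex_of_real (f (l i))) * mat_adjoint U"
  have "mat_adjoint (1\<^sub>m n :: complex mat) = 1\<^sub>m n"
    by (rule eq_matI) (auto simp: mat_adjoint_def mat_of_rows_def one_mat_def)
  then have "?Q ?R"
    by (intro exI[of _ "1\<^sub>m n"] exI[of _ a]) (simp add: mat_diag_def)
  moreover have "B = ?R" if "?Q B" for B
  proof -
    from that obtain U l where U: "U \<in> carrier_mat n n" and UU: "mat_adjoint U * U = 1\<^sub>m n"
      and A: "?A = U * mat_diag n (\<lambda>i. complex_of_real (l i)) * mat_adjoint U"
      and B: "B = U * mat_diag n (\<lambda>i. complex_of_real (f (l i))) * mat_adjoint U" by blast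
    have ad: "mat_adjoint U \<in> carrier_mat n n" using U
      by (simp add: mat_adjoint_def mat_of_rows_def)
    have UU': "U * mat_adjoint U = 1\<^sub>m n" using mat_mult_left_right_inverse[OF ad U UU] .
    have "?A * U = U * mat_diag n (\<lambda>i. complex_of_real (l i)) * (mat_adjoint U * U)"
      unfolding A using U ad by (simp add: assoc_mult_mat[of _ n n _ n _ n] mult_carrier_mat[of _ n n _ n])
    then have AU: "?A * U = U * mat_diag n (\<lambda>i. complex_of_real (l i))"
      unfolding UU using U by (simp add: mat_diag_def)
    have "?R * U = U * mat_diag n (\<lambda>i. complex_of_real (f (l i)))"
    proof (rule eq_matI)
      fix i j assume "i < dim_row (U * mat_diag n (\<lambda>i. complex_of_real (f (l i))))"
        "j < dim_col (U * mat_diag n (\<lambda>i. complex_of_real (f (l i))))"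
      then have ij: "i < n" "j < n" using U by (auto simp: mat_diag_def)
      have "(?A * U) $$ (i, j) = (U * mat_diag n (\<lambda>i. complex_of_real (l i))) $$ (i, j)"
        by (simp add: AU)
      then have "complex_of_real (a i) * U $$ (i, j) = U $$ (i, j) * complex_of_real (l j)"
        using U ij by (simp add: mat_diag_mult_left mat_diag_mult_right)
      \<comment> \<open>\<open>U\<close> links only indices with equal eigenvalues, so
        \<open>f\<close> may be applied on both sides. Hence every diagonalisation gives the same
        matrix, and the choice in \<open>hermitian_fun\<close> is determined.\<close>
      then have "U $$ (i, j) = 0 \<or> a i = l j" by auto
      then show "(?R * U) $$ (i, j) = (U * mat_diag n (\<lambda>i. complex_of_real (f (l i)))) $$ (i, j)"
        using U ij by (auto simp: mat_diag_mult_left mat_diag_mult_right)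
    qed (use U in \<open>auto simp: mat_diag_def\<close>)
    then have "B = ?R * U * mat_adjoint U" by (simp add: B)
    also have "\<dots> = ?R * (U * mat_adjoint U)"
      using U ad by (simp add: assoc_mult_mat[of _ n n _ n _ n] mult_carrier_mat[of _ n n _ n])
    also have "\<dots> = ?R" unfolding UU' by (simp add: mat_diag_def)
    finally show ?thesis .
  qed
  ultimately have "(SOME B. ?Q B) = ?R" by (rule some_equality)
  then show ?thesis unfolding hermitian_fun_def Let_def by (simp add: mat_diag_def)
qed

lemma vn_entropy_mat_diag:
  "vn_entropy (mat_diag n (\<lambda>i. complex_of_real (p i))) = - (\<Sum>i<n. p i * log 2 (p i))"
proof -
  have "mat_diag n (\<lambda>i. complex_of_real (log 2 (p i))) \<in> carrier_mat n n" by (simp add: mat_diag_def)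
  then show ?thesis
    unfolding vn_entropy_def hermitian_fun_mat_diag
    by (subst mat_trace_mat_diag_mult) (auto simp: mat_diag_def)
qed

lemma mixture_mat_diag:
  "mixture d B (\<lambda>x. mat_diag d (\<lambda>i. complex_of_real (p x i))) Q =
   mat_diag d (\<lambda>i. complex_of_real (\<Sum>x\<in>B. pmf Q x * p x i))"
  by (rule eq_matI) (auto simp: mixture_def mat_sum_def mat_diag_def)

lemma holevo_mat_diag:
  "holevo d B Q (\<lambda>x. mat_diag d (\<lambda>i. complex_of_real (p x i))) =
   (\<Sum>x\<in>B. pmf Q x * (\<Sum>i<d. p x i * log 2 (p x i)))
   - (\<Sum>i<d. (\<Sum>x\<in>B. pmf Q x * p x i) * log 2 (\<Sum>x\<in>B. pmf Q x * p x i))"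
  unfolding holevo_def mixture_mat_diag vn_entropy_mat_diag by (simp add: sum_negf)


section \<open>Words and the outputs they produce\<close>

lemma finite_words: "finite A \<Longrightarrow> finite (words n A)"
  using finite_lists_length_eq[of A n] by (auto simp: words_def conj_commute elim: rev_finite_subset)

lemma card_words: "finite A \<Longrightarrow> card (words n A) = card A ^ n"
  using card_lists_length_eq[of A n] by (simp add: words_def conj_commute)

lemma words_Suc: "words (Suc n) A = (\<lambda>(a, as). a # as) ` (A \<times> words n A)"
  by (auto simp: words_def length_Suc_conv image_iff)

lemma words_0: "words 0 A = {[]}"
  by (auto simp: words_def)

lemma words_SucE:
  assumes "xs \<in> words (Suc n) A"
  obtains y ys where "xs = y # ys" "y \<in> A" "ys \<in> words n A"
  using assms by (auto simp: words_Suc)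

lemma replicate_in_words: "a \<in> A \<Longrightarrow> replicate n a \<in> words n A"
  by (auto simp: words_def)

lemma zip_words:
  assumes "ts \<in> words n S" "as \<in> words n A" "(t, a) \<in> set (zip ts as)"
  shows "t \<in> S" "a \<in> A"
  using assms by (auto simp: words_def dest: set_zip_leftD set_zip_rightD)

lemma radix_words_less:
  assumes "ts \<in> words n S" "as \<in> words n A" "\<And>t a. t \<in> S \<Longrightarrow> a \<in> A \<Longrightarrow> y t a < d"
  shows "radix d (map2 y ts as) < d ^ n"
proof -
  have "set (map2 y ts as) \<subseteq> {..<d}" using zip_words[OF assms(1,2)] assms(3) by auto
  moreover have "length (map2 y ts as) = n" using assms by (simp add: words_def)
  ultimately show ?thesis using radix_less by metis
qed

lemma mixture_words_basis_proj:
  assumes "ts \<in> words n S" "\<And>t a. t \<in> S \<Longrightarrow> a \<in> A \<Longrightarrow> W t a = basis_proj d (y t a) \<and> y t a < d"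
  shows "mixture (d ^ length ts) (words (length ts) A) (\<lambda>as. kron_list (map2 W ts as)) P =
    mixture (d ^ n) (words n A) (\<lambda>as. basis_proj (d ^ n) (radix d (map2 y ts as))) P"
proof -
  have n: "length ts = n" using assms by (simp add: words_def)
  show ?thesis unfolding n
  proof (rule mixture_cong)
    fix as assume as: "as \<in> words n A"
    show "kron_list (map2 W ts as) = basis_proj (d ^ n) (radix d (map2 y ts as))"
      unfolding n[symmetric]
    proof (rule kron_list_basis_proj)
      show "length ts = length as" using as n by (simp add: words_def)
      show "W t a = basis_proj d (y t a) \<and> y t a < d" if "(t, a) \<in> set (zip ts as)" for t a
        using assms(2) zip_words[OF assms(1) as that] by blast
    qed
  qed simp
qed

subsection \<open>Codes for classical channels\<close>

definition classical_rcv :: "('t, 'a) avcqwc \<Rightarrow> ('t \<Rightarrow> 'a \<Rightarrow> nat) \<Rightarrow> bool" where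
  "classical_rcv C y \<longleftrightarrow> finite (alphabet C) \<and>
    (\<forall>t\<in>states C. \<forall>a\<in>alphabet C. rcv C t a = basis_proj (dim_rcv C) (y t a) \<and> y t a < dim_rcv C)"

lemma error_prob_classical:
  assumes "is_code C n J E D" "ts \<in> words n (states C)" "classical_rcv C y"
  shows "error_prob C J E D ts = 1 - (1 / real J) * (\<Sum>j=1..J. \<Sum>as\<in>words n (alphabet C).
    pmf (E j) as * Re (D j $$ (radix (dim_rcv C) (map2 y ts as), radix (dim_rcv C) (map2 y ts as))))"
proof -
  have y: "\<And>t a. t \<in> states C \<Longrightarrow> a \<in> alphabet C \<Longrightarrow>
      rcv C t a = basis_proj (dim_rcv C) (y t a) \<and> y t a < dim_rcv C"
    using assms(3) by (auto simp: classical_rcv_def)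
  have "Re (mat_trace (rcv_out C ts (E j) * D j)) = (\<Sum>as\<in>words n (alphabet C).
    pmf (E j) as * Re (D j $$ (radix (dim_rcv C) (map2 y ts as), radix (dim_rcv C) (map2 y ts as))))"
    if "j \<in> {1..J}" for j
  proof -
    have out: "rcv_out C ts (E j) = mixture (dim_rcv C ^ n) (words n (alphabet C))
        (\<lambda>as. basis_proj (dim_rcv C ^ n) (radix (dim_rcv C) (map2 y ts as))) (E j)"
      unfolding rcv_out_def by (rule mixture_words_basis_proj[OF assms(2)]) (rule y)
    show ?thesis unfolding out
    proof (rule success_basis_proj)
    show "D j \<in> carrier_mat (dim_rcv C ^ n) (dim_rcv C ^ n)"
      using assms(1) that by (auto simp: is_code_def pos_semidef_def)
    show "finite (words n (alphabet C))" using assms(3) by (simp add: classical_rcv_def finite_words)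
    show "radix (dim_rcv C) (map2 y ts as) < dim_rcv C ^ n" if "as \<in> words n (alphabet C)" for as
      using radix_words_less[OF assms(2) that] y by blast
    qed
  qed
  then show ?thesis by (simp add: error_prob_def)
qed

text \<open>For a fixed classical output \<open>i\<close> the diagonal entries form a probability
  distribution over the messages: the measurement acts as a randomised classical decoder.\<close>

lemma code_diag:
  assumes "is_code C n J E D" "i < dim_rcv C ^ n"
  shows "j \<in> {1..J} \<Longrightarrow> 0 \<le> Re (D j $$ (i, i))" "(\<Sum>j=1..J. Re (D j $$ (i, i))) = 1"
proof -
  show "j \<in> {1..J} \<Longrightarrow> 0 \<le> Re (D j $$ (i, i))"
    using assms by (auto simp: is_code_def intro: pos_semidef_diag_nonneg)
  have "mat_sum (dim_rcv C ^ n) D {1..J} $$ (i, i) = 1"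
    using assms by (simp add: is_code_def)
  then have "(\<Sum>j=1..J. D j $$ (i, i)) = 1" using assms(2) by (simp add: mat_sum_def)
  then show "(\<Sum>j=1..J. Re (D j $$ (i, i))) = 1" by (metis Re_sum one_complex.sel(1))
qed

text \<open>The average of equal states is the same state, and the weights sum to 1, so the two
  entropy terms cancel.\<close>

lemma holevo_const:
  assumes "finite B" "B \<noteq> {}" "\<sigma> \<in> carrier_mat d d" "\<And>x. x \<in> B \<Longrightarrow> \<rho> x = \<sigma>"
  shows "holevo d B (pmf_of_set B) \<rho> = 0"
proof -
  have s: "(\<Sum>x\<in>B. pmf (pmf_of_set B) x) = 1" using assms by (intro sum_pmf_eq_1) auto
  have "mixture d B \<rho> (pmf_of_set B) = mixture d B (\<lambda>_. \<sigma>) (pmf_of_set B)"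
    using assms by (intro mixture_cong) auto
  also have "\<dots> = \<sigma>"
    using assms(3) s
    by (intro eq_matI) (auto simp: mixture_def mat_sum_def simp flip: sum_distrib_right of_real_sum)
  finally have "mixture d B \<rho> (pmf_of_set B) = \<sigma>" .
  then show ?thesis using s assms(4) by (simp add: holevo_def flip: sum_distrib_right)
qed

lemma tap_out_carrier: "tap_out C ts P \<in> carrier_mat (dim_tap C ^ length ts) (dim_tap C ^ length ts)"
  by (simp add: tap_out_def mixture_def mat_sum_def)

text \<open>A code with one message has rate 0, is always decoded correctly by the identity
  operator, and has nothing to leak.\<close>

lemma zero_rate_achievable:
  assumes C: "is_avcqwc C" and y: "classical_rcv C y"
  shows "achievable_secrecy_rate C 0"
  unfolding achievable_secrecy_rate_def
proof (intro conjI allI impI)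
  fix \<epsilon> \<delta> \<zeta> :: real assume pos: "\<epsilon> > 0" "\<delta> > 0" "\<zeta> > 0"
  obtain t a where ta: "t \<in> states C" "a \<in> alphabet C" using C by (auto simp: is_avcqwc_def)
  show "\<forall>\<^sub>F n in sequentially. \<exists>J E D. is_code C n J E D \<and> log 2 (real J) / real n > 0 - \<delta> \<and>
          (MAX ts \<in> words n (states C). error_prob C J E D ts) < \<epsilon> \<and>
          (MAX ts \<in> words n (states C). leakage C J E ts) < \<zeta>"
    using eventually_gt_at_top[of 0]
  proof eventually_elim
    case (elim n)
    define E where "E = (\<lambda>j::nat. return_pmf (replicate n a))"
    define D where "D = (\<lambda>j::nat. 1\<^sub>m (dim_rcv C ^ n) :: complex mat)"
    have D: "D = (\<lambda>j. mat_diag (dim_rcv C ^ n) (\<lambda>_. 1))" by (simp add: D_def)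
    have "pos_semidef (dim_rcv C ^ n) (D j)" for j
      unfolding D by (rule pos_semidef_mat_diag) (simp add: less_eq_complex_def)
    then have code: "is_code C n 1 E D"
      using elim ta by (auto simp: is_code_def E_def replicate_in_words D_def mat_sum_def intro!: eq_matI)
    have w: "finite (words n (states C))" "words n (states C) \<noteq> {}"
      using C ta replicate_in_words[of t "states C" n] by (auto simp: is_avcqwc_def finite_words)
    have fA: "finite (words n (alphabet C))" using C by (simp add: is_avcqwc_def finite_words)
    have "error_prob C 1 E D ts = 0" if "ts \<in> words n (states C)" for ts
    proof -
      have "(\<Sum>as\<in>words n (alphabet C). pmf (E 1) as * Re (D 1 $$ (radix (dim_rcv C) (map2 y ts as),
          radix (dim_rcv C) (map2 y ts as)))) = (\<Sum>as\<in>words n (alphabet C). pmf (E 1) as)"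
      proof (intro sum.cong refl)
        fix as assume "as \<in> words n (alphabet C)"
        with that have "radix (dim_rcv C) (map2 y ts as) < dim_rcv C ^ n"
          by (rule radix_words_less) (use y in \<open>auto simp: classical_rcv_def\<close>)
        then show "pmf (E 1) as * Re (D 1 $$ (radix (dim_rcv C) (map2 y ts as),
          radix (dim_rcv C) (map2 y ts as))) = pmf (E 1) as" by (simp add: D_def)
      qed
      also have "\<dots> = 1" using fA code by (intro sum_pmf_eq_1) (auto simp: is_code_def)
      finally show ?thesis unfolding error_prob_classical[OF code that y] by simp
    qed
    \<comment> \<open>With one message the family of wiretapper states has one member and is
      trivially constant.\<close>
    moreover have "leakage C 1 E ts = 0" for ts
      unfolding leakage_def by (rule holevo_const[OF _ _ tap_out_carrier[of C ts "E 1"]]) auto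
    ultimately show ?case
      using pos w by (intro exI[of _ 1] exI[of _ E] exI[of _ D]) (auto simp: code[unfolded One_nat_def])
  qed
qed simp

text \<open>Achievability of 0 must be supplied because in \<open>ereal\<close> the supremum of the
  empty set is minus infinity.\<close>

lemma secrecy_capacity_zeroI:
  assumes "achievable_secrecy_rate C 0" "\<And>R. R > 0 \<Longrightarrow> \<not> achievable_secrecy_rate C R"
  shows "secrecy_capacity C = 0"
  unfolding secrecy_capacity_def
proof (rule antisym)
  show "Sup (ereal ` {R. achievable_secrecy_rate C R}) \<le> 0"
    using assms(2) by (intro Sup_least) (force simp: not_less[symmetric])
  show "0 \<le> Sup (ereal ` {R. achievable_secrecy_rate C R})"
    using assms(1) by (intro Sup_upper) (auto simp: zero_ereal_def)
qed

text \<open>Choosing the slack \<open>\<delta> = R\<close> turns the rate condition into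
  \<open>log 2 J / n > 0\<close>, which excludes \<open>J = 1\<close>. Both converses then need only
  one block length and a code with two or more messages.\<close>

lemma positive_rate_code:
  assumes "achievable_secrecy_rate C R" "R > 0" "finite (states C)" "\<epsilon> > 0" "\<zeta> > 0"
  obtains n J E D where "is_code C n J E D" "2 \<le> J"
    "\<And>ts. ts \<in> words n (states C) \<Longrightarrow> error_prob C J E D ts < \<epsilon>"
    "\<And>ts. ts \<in> words n (states C) \<Longrightarrow> leakage C J E ts < \<zeta>"
proof -
  have "\<forall>\<^sub>F n in sequentially. \<exists>J E D. is_code C n J E D \<and> log 2 (real J) / real n > R - R \<and>
          (MAX ts \<in> words n (states C). error_prob C J E D ts) < \<epsilon> \<and>
          (MAX ts \<in> words n (states C). leakage C J E ts) < \<zeta>"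
    using assms unfolding achievable_secrecy_rate_def by blast
  then obtain n J E D where code: "is_code C n J E D" "log 2 (real J) / real n > 0"
    and m: "(MAX ts \<in> words n (states C). error_prob C J E D ts) < \<epsilon>"
      "(MAX ts \<in> words n (states C). leakage C J E ts) < \<zeta>"
    by (auto simp: eventually_sequentially)
  have fin: "finite (words n (states C))" using assms by (simp add: finite_words)
  have "J > 0" using code(1) by (simp add: is_code_def)
  moreover have "J \<noteq> 1" using code(2) by auto
  ultimately have "2 \<le> J" by linarith
  with code(1) show thesis
  proof (rule that)
    fix ts assume ts: "ts \<in> words n (states C)"
    have "error_prob C J E D ts \<le> (MAX ts \<in> words n (states C). error_prob C J E D ts)"
      "leakage C J E ts \<le> (MAX ts \<in> words n (states C). leakage C J E ts)"
      using ts fin by (auto intro: Max_ge)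
    then show "error_prob C J E D ts < \<epsilon>" "leakage C J E ts < \<zeta>" using m by linarith+
  qed
qed

subsection \<open>Two channels of capacity zero\<close>

text \<open>Addition is that of the naturals, not modulo 2: outputs 0 and 2 reveal both bits and
  only 1 is ambiguous. A wiretapper space of dimension 1 carries a single density operator.\<close>

definition add_channel :: "(nat, nat) avcqwc" where
  "add_channel = \<lparr> states = {0, 1}, alphabet = {0, 1}, dim_rcv = 3,
     rcv = (\<lambda>t a. basis_proj 3 (t + a)), dim_tap = 1, tap = (\<lambda>t a. basis_proj 1 0) \<rparr>"

text \<open>A single state leaves the jammer no choice, so only secrecy can fail here.\<close>

definition public_channel :: "(nat, nat) avcqwc" where
  "public_channel = \<lparr> states = {0}, alphabet = {0, 1}, dim_rcv = 2,
     rcv = (\<lambda>t a. basis_proj 2 a), dim_tap = 2, tap = (\<lambda>t a. basis_proj 2 a) \<rparr>"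

lemma is_avcqwc_add: "is_avcqwc add_channel"
  by (auto simp: is_avcqwc_def add_channel_def cq_channel_def intro: basis_proj_density)

lemma is_avcqwc_public: "is_avcqwc public_channel"
  by (auto simp: is_avcqwc_def public_channel_def cq_channel_def intro: basis_proj_density)

lemma classical_rcv_add: "classical_rcv add_channel (+)"
  by (auto simp: classical_rcv_def add_channel_def)

lemma classical_rcv_public: "classical_rcv public_channel (\<lambda>t a. a)"
  by (auto simp: classical_rcv_def public_channel_def)

section \<open>Symmetrizability of the adding channel\<close>

lemma map2_add_commute: "map2 (+) xs ys = map2 (+) ys (xs :: nat list)"
  by (subst zip_commute) (auto simp: add.commute intro: map_cong)

text \<open>The output does not change when the words of sender and jammer are exchanged. If the
  jammer imitates a random message, the decoder cannot tell which of the two messages is the true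
  one and is right at most half of the time, up to the coincidence of both.\<close>

lemma symmetrizable_not_achievable:
  assumes "R > 0" shows "\<not> achievable_secrecy_rate add_channel R"
proof
  assume "achievable_secrecy_rate add_channel R"
  \<comment> \<open>Success above 7/8 is to be contradicted by the bound
    \<open>(J + 1) / (2 * J)\<close>, which is at most 3/4 for \<open>J >= 2\<close>.\<close>
  then obtain n J E D where code: "is_code add_channel n J E D" and J: "2 \<le> J"
    and err: "\<And>ts. ts \<in> words n (states add_channel) \<Longrightarrow> error_prob add_channel J E D ts < 1/8"
    using assms by (rule positive_rate_code[where \<epsilon> = "1/8" and \<zeta> = 1]) (auto simp: add_channel_def)
  define W where "W = words n {0, 1 :: nat}"
  define f where "f j ts as = Re (D j $$ (radix 3 (map2 (+) ts as), radix 3 (map2 (+) ts as)))"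
    for j and ts as :: "nat list"
  define p where "p j as = pmf (E j) as" for j as
  have S: "states add_channel = {0, 1}" "alphabet add_channel = {0, 1}" "dim_rcv add_channel = 3"
    by (auto simp: add_channel_def)
  have fin: "finite W" by (simp add: W_def finite_words)
  have f_sym: "f j ts as = f j as ts" for j ts as
    unfolding f_def using map2_add_commute[of ts as] by simp
  have less: "radix 3 (map2 (+) ts as) < 3 ^ n" if "ts \<in> W" "as \<in> W" for ts as
    using that unfolding W_def by (rule radix_words_less) auto
  have f_nonneg: "f j ts as \<ge> 0" if "ts \<in> W" "as \<in> W" "j \<in> {1..J}" for j ts as
    using code_diag(1)[OF code] less that by (auto simp: f_def S)
  have f_sum: "(\<Sum>j=1..J. f j ts as) = 1" if "ts \<in> W" "as \<in> W" for ts as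
    using code_diag(2)[OF code] less that by (auto simp: f_def S)
  have p_sum: "(\<Sum>as\<in>W. p j as) = 1" if "j \<in> {1..J}" for j
    using that code fin unfolding p_def by (intro sum_pmf_eq_1) (auto simp: is_code_def S W_def)
  have p_nonneg: "p j as \<ge> 0" for j as by (simp add: p_def)
  have suc: "(\<Sum>j=1..J. \<Sum>as\<in>W. p j as * f j ts as) > 7/8 * J" if "ts \<in> W" for ts
    using err[of ts] error_prob_classical[OF code _ classical_rcv_add, of ts] that J
    by (simp add: S W_def p_def f_def field_simps)
  \<comment> \<open>\<open>G i j\<close>: success probability of message \<open>j\<close> if the jammer plays a random codeword of message \<open>i\<close>\<close>
  define G where "G i j = (\<Sum>ts\<in>W. \<Sum>as\<in>W. p i ts * (p j as * f j ts as))" for i j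
  have const: "(\<Sum>i=1..J. \<Sum>ts\<in>W. p i ts * (7/8 * J)) = 7/8 * J * J"
  proof -
    have "(\<Sum>ts\<in>W. p i ts * (7/8 * J)) = 7/8 * J" if "i \<in> {1..J}" for i
      unfolding sum_distrib_right[symmetric] p_sum[OF that] by simp
    then have "(\<Sum>i=1..J. \<Sum>ts\<in>W. p i ts * (7/8 * J)) = (\<Sum>i=1..J. 7/8 * real J)"
      by (intro sum.cong) auto
    then show ?thesis by simp
  qed
  \<comment> \<open>The error bound holds for every state sequence, hence also on average over the
    random words of the jammer.\<close>
  have "(\<Sum>i=1..J. \<Sum>j=1..J. G i j) = (\<Sum>i=1..J. \<Sum>ts\<in>W. p i ts * (\<Sum>j=1..J. \<Sum>as\<in>W. p j as * f j ts as))"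
    unfolding G_def by (subst sum.swap[of _ W]) (simp add: sum_distrib_left)
  also have "\<dots> \<ge> (\<Sum>i=1..J. \<Sum>ts\<in>W. p i ts * (7/8 * J))"
    using suc p_nonneg by (intro sum_mono mult_left_mono) (auto simp: less_imp_le)
  finally have lower: "(\<Sum>i=1..J. \<Sum>j=1..J. G i j) \<ge> 7/8 * J * J"
    unfolding const .
  \<comment> \<open>By \<open>f_sym\<close>, \<open>G i j\<close> and \<open>G j i\<close> average
    over the same outputs, once with decision \<open>j\<close> and once with decision
    \<open>i\<close>. For distinct messages these decisions exclude each other; for
    \<open>i = j\<close> only the trivial bound 2 remains.\<close>
  have pair: "G i j + G j i \<le> 1 + of_bool (i = j)" if "i \<in> {1..J}" "j \<in> {1..J}" for i j
  proof -
    have "G j i = (\<Sum>ts\<in>W. \<Sum>as\<in>W. p i ts * (p j as * f i ts as))"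
      unfolding G_def by (subst sum.swap) (auto simp: f_sym mult_ac)
    then have "G i j + G j i = (\<Sum>ts\<in>W. \<Sum>as\<in>W. p i ts * (p j as * (f j ts as + f i ts as)))"
      by (simp add: G_def sum.distrib distrib_left)
    also have "\<dots> \<le> (\<Sum>ts\<in>W. \<Sum>as\<in>W. p i ts * (p j as * (1 + of_bool (i = j))))"
    proof (intro sum_mono mult_left_mono)
      fix ts as assume w: "ts \<in> W" "as \<in> W"
      have "f j ts as + f i ts as \<le> (\<Sum>k=1..J. f k ts as)" if "i \<noteq> j"
      proof -
        have "f j ts as + f i ts as = (\<Sum>k\<in>{i, j}. f k ts as)" using that by simp
        also have "\<dots> \<le> (\<Sum>k=1..J. f k ts as)"
          using \<open>i \<in> _\<close> \<open>j \<in> _\<close> w f_nonneg by (intro sum_mono2) auto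
        finally show ?thesis .
      qed
      moreover have "f i ts as \<le> (\<Sum>k=1..J. f k ts as)"
        using \<open>i \<in> _\<close> w f_nonneg by (intro member_le_sum) auto
      ultimately show "f j ts as + f i ts as \<le> 1 + of_bool (i = j)"
        using f_sum[OF w] by auto
    qed (auto simp: p_nonneg)
    also have "\<dots> = 1 + of_bool (i = j)"
      using that by (simp add: p_sum flip: sum_distrib_right sum_distrib_left)
    finally show ?thesis .
  qed
  have "2 * (\<Sum>i=1..J. \<Sum>j=1..J. G i j) = (\<Sum>i=1..J. \<Sum>j=1..J. G i j) + (\<Sum>i=1..J. \<Sum>j=1..J. G j i)"
    by (subst (3) sum.swap) simp
  also have "\<dots> = (\<Sum>i=1..J. \<Sum>j=1..J. G i j + G j i)" by (simp add: sum.distrib)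
  also have "\<dots> \<le> (\<Sum>i=1..J. \<Sum>j=1..J. 1 + of_bool (i = j))"
    using pair by (intro sum_mono) auto
  also have "\<dots> = real J * J + J" by (simp add: sum.distrib of_bool_def distrib_left)
  finally have "7/4 * (real J * J) \<le> real J * J + J" using lower by simp
  \<comment> \<open>Cancelling \<open>J\<close> leaves \<open>3/4 * J <= 1\<close>, impossible for
    \<open>J >= 2\<close>.\<close>
  then have "real J * (3/4 * J) \<le> real J * 1" by (simp add: algebra_simps)
  then show False using J by (subst (asm) mult_le_cancel_left_pos) auto
qed

lemma secrecy_capacity_add: "secrecy_capacity add_channel = 0"
  using zero_rate_achievable[OF is_avcqwc_add classical_rcv_add] symmetrizable_not_achievable
  by (rule secrecy_capacity_zeroI)

section \<open>Reliable decoding forces leakage\<close>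

lemma relative_entropy_term_ge:
  fixes p q f :: real
  assumes "0 \<le> p" "0 \<le> q" "q = 0 \<longrightarrow> p = 0" "0 \<le> f" "f \<le> 1"
  shows "4/3 * f * p - (1/2 + f) * q \<le> p * (ln p - ln q)"
proof (cases "p = 0")
  case True
  then show ?thesis using assms by simp
next
  case False
  then have pq: "p > 0" "q > 0" using assms by auto
  \<comment> \<open>\<open>g\<close> is a test likelihood ratio in the variational bound \<open>ln (p/q) \<ge> ln g + 1 - g q/p\<close>\<close>
  define g where "g = 1/2 + f"
  have g: "g > 0" using assms by (simp add: g_def)
  have "ln (g * q / p) \<le> g * q / p - 1" using g pq by (intro ln_le_minus_one) auto
  moreover have "ln (g * q / p) = ln g + ln q - ln p" using g pq by (simp add: ln_div ln_mult)
  moreover have "1 - 1 / g \<le> ln g" using ln_le_minus_one[of "1/g"] g by (simp add: ln_div)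
  \<comment> \<open>The concave function \<open>2 - 1 / (1/2 + f)\<close> lies above its chord on
    the unit interval; the chord runs from 0 at \<open>f = 0\<close> to 4/3 at \<open>f = 1\<close>,
    which is the origin of the constant 4/3.\<close>
  moreover have "4/3 * f - 1 \<le> 1 - 1 / g"
  proof -
    have "0 \<le> f * (1 - f)" using assms by simp
    then show ?thesis using g by (simp add: g_def field_simps)
  qed
  ultimately have "4/3 * f - g * q / p \<le> ln p - ln q" by linarith
  then have "p * (4/3 * f - g * q / p) \<le> p * (ln p - ln q)" using pq by (intro mult_left_mono) auto
  moreover have "p * (4/3 * f - g * q / p) = 4/3 * f * p - (1/2 + f) * q"
    using pq by (simp add: g_def right_diff_distrib)
  ultimately show ?thesis by simp
qed

text \<open>For diagonal states the Holevo quantity is the mean relative entropy of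
  \<open>p j\<close> to the average \<open>q\<close>. The decoder \<open>f\<close> serves as the
  test in \<open>relative_entropy_term_ge\<close>: it succeeds under \<open>p j\<close>, whereas
  under \<open>q\<close> it can only guess, with success \<open>1 / J\<close>.\<close>

lemma holevo_ge_success:
  fixes p f :: "nat \<Rightarrow> nat \<Rightarrow> real"
  assumes J: "0 < J" and p: "\<And>j i. 0 \<le> p j i" "\<And>j. j \<in> {1..J} \<Longrightarrow> (\<Sum>i<d. p j i) = 1"
    and f: "\<And>j i. i < d \<Longrightarrow> j \<in> {1..J} \<Longrightarrow> 0 \<le> f j i" "\<And>i. i < d \<Longrightarrow> (\<Sum>j=1..J. f j i) = 1"
  shows "4/3 * (1 / J * (\<Sum>j=1..J. \<Sum>i<d. p j i * f j i)) - 1/2 - 1 / J \<le>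
    ln 2 * holevo d {1..J} (pmf_of_set {1..J}) (\<lambda>j. mat_diag d (\<lambda>i. complex_of_real (p j i)))"
proof -
  define q where "q i = (\<Sum>j=1..J. 1 / J * p j i)" for i
  have "(\<Sum>i<d. q i) = (\<Sum>j=1..J. 1 / J * (\<Sum>i<d. p j i))"
    unfolding q_def by (subst sum.swap) (simp add: sum_distrib_left)
  also have "\<dots> = 1" using J p(2) by simp
  finally have q_sum: "(\<Sum>i<d. q i) = 1" .
  have q_nonneg: "0 \<le> q i" for i unfolding q_def using p by (intro sum_nonneg) auto
  have f_le: "f j i \<le> 1" if "i < d" "j \<in> {1..J}" for j i
    using f(2)[OF that(1)] member_le_sum[of j "{1..J}" "\<lambda>j. f j i"] f(1)[OF that(1)] that(2) by auto
  \<comment> \<open>Absolute continuity: each \<open>p j\<close> enters the average with the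
    positive weight \<open>1 / J\<close>.\<close>
  have q0: "p j i = 0" if "q i = 0" "j \<in> {1..J}" for i j
    using that J p(1) unfolding q_def by (subst (asm) sum_nonneg_eq_0_iff) auto
  \<comment> \<open>The factor \<open>ln 2\<close> converts bits to natural logarithms.\<close>
  have hol: "ln 2 * holevo d {1..J} (pmf_of_set {1..J}) (\<lambda>j. mat_diag d (\<lambda>i. complex_of_real (p j i)))
      = (\<Sum>j=1..J. \<Sum>i<d. 1 / J * (p j i * (ln (p j i) - ln (q i))))"
  proof -
    have avg: "(\<Sum>j=1..J. pmf (pmf_of_set {1..J}) j * g j) = (\<Sum>j=1..J. 1 / J * g j)" for g
      using J by (intro sum.cong) auto
    have "holevo d {1..J} (pmf_of_set {1..J}) (\<lambda>j. mat_diag d (\<lambda>i. complex_of_real (p j i)))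
       = (\<Sum>j=1..J. 1 / J * (\<Sum>i<d. p j i * log 2 (p j i))) - (\<Sum>i<d. q i * log 2 (q i))"
      unfolding holevo_mat_diag q_def avg ..
    moreover have "(\<Sum>i<d. q i * log 2 (q i)) = (\<Sum>j=1..J. \<Sum>i<d. 1 / J * p j i * log 2 (q i))"
      by (subst sum.swap) (simp add: q_def sum_distrib_right)
    ultimately show ?thesis
      by (simp add: log_def sum_distrib_left sum_subtractf[symmetric] right_diff_distrib diff_divide_distrib)
  qed
  have "(\<Sum>j=1..J. \<Sum>i<d. 1 / J * (4/3 * f j i * p j i - (1/2 + f j i) * q i))
    \<le> (\<Sum>j=1..J. \<Sum>i<d. 1 / J * (p j i * (ln (p j i) - ln (q i))))"
    using p q_nonneg q0 f(1) f_le
    by (intro sum_mono mult_left_mono relative_entropy_term_ge) auto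
  also have "(\<Sum>j=1..J. \<Sum>i<d. 1 / J * (4/3 * f j i * p j i - (1/2 + f j i) * q i)) =
    4/3 * (1 / J * (\<Sum>j=1..J. \<Sum>i<d. p j i * f j i))
     - (\<Sum>j=1..J. \<Sum>i<d. 1 / J * ((1/2 + f j i) * q i))"
    by (simp add: sum_distrib_left sum_subtractf right_diff_distrib diff_divide_distrib mult_ac)
  \<comment> \<open>Since \<open>q\<close> does not depend on \<open>j\<close>, the sum over
    messages can be taken first, where the decisions \<open>f\<close> add up to 1.\<close>
  also have "(\<Sum>j=1..J. \<Sum>i<d. 1 / J * ((1/2 + f j i) * q i)) =
     (\<Sum>i<d. 1 / J * (J / 2 + (\<Sum>j=1..J. f j i)) * q i)"
    by (subst sum.swap) (simp add: sum_distrib_left[symmetric] sum_distrib_right[symmetric] sum.distrib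
        sum_divide_distrib[symmetric])
  also have "\<dots> = (\<Sum>i<d. 1 / J * (J / 2 + 1) * q i)" using f(2) by (intro sum.cong) auto
  also have "\<dots> = 1/2 + 1 / J"
    using J q_sum by (simp only: sum_distrib_left[symmetric]) (simp add: field_simps)
  finally show ?thesis using hol by simp
qed

text \<open>The wiretapper holds exactly the output of the receiver, so the decoder of the receiver
  certifies a leakage that reliability keeps away from 0.\<close>

lemma public_not_achievable:
  assumes "R > 0" shows "\<not> achievable_secrecy_rate public_channel R"
proof
  assume "achievable_secrecy_rate public_channel R"
  \<comment> \<open>With success above 9/10 and \<open>J >= 2\<close> the bound exceeds
    \<open>4/3 * 9/10 - 1/2 - 1/2 = 1/5\<close>; as \<open>ln 2 <= 1\<close>, this contradicts
    leakage below 1/5.\<close>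
  then obtain n J E D where code: "is_code public_channel n J E D" and J: "2 \<le> J"
    and err: "\<And>ts. ts \<in> words n (states public_channel) \<Longrightarrow> error_prob public_channel J E D ts < 1/10"
    and leak: "\<And>ts. ts \<in> words n (states public_channel) \<Longrightarrow> leakage public_channel J E ts < 1/5"
    using assms
    by (rule positive_rate_code[where \<epsilon> = "1/10" and \<zeta> = "1/5"]) (auto simp: public_channel_def)
  define ts where "ts = replicate n (0::nat)"
  define W where "W = words n {0, 1 :: nat}"
  define e where "e as = radix 2 (map2 (\<lambda>t a. a) ts as)" for as
  define p where "p j i = (\<Sum>as\<in>W. pmf (E j) as * of_bool (e as = i))" for j i
  define f where "f j i = Re (D j $$ (i, i))" for j i
  have S: "states public_channel = {0}" "alphabet public_channel = {0, 1}"
    "dim_rcv public_channel = 2" "dim_tap public_channel = 2"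
    "tap public_channel = (\<lambda>t a. basis_proj 2 a)"
    by (auto simp: public_channel_def)
  have ts: "ts \<in> words n (states public_channel)" by (simp add: ts_def replicate_in_words S)
  have fin: "finite W" by (simp add: W_def finite_words)
  have less: "e as < 2 ^ n" if "as \<in> W" for as
    unfolding e_def using ts that unfolding W_def by (rule radix_words_less) auto
  have swap: "(\<Sum>i<2 ^ n. p j i * g i) = (\<Sum>as\<in>W. pmf (E j) as * g (e as))" for j g
  proof -
    have "(\<Sum>i<2 ^ n. p j i * g i) = (\<Sum>as\<in>W. \<Sum>i<2 ^ n. if e as = i then pmf (E j) as * g i else 0)"
      unfolding p_def sum_distrib_right by (subst sum.swap) (auto intro!: sum.cong)
    also have "\<dots> = (\<Sum>as\<in>W. pmf (E j) as * g (e as))" using less by (intro sum.cong) auto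
    finally show ?thesis .
  qed
  have "error_prob public_channel J E D ts = 1 - 1 / J * (\<Sum>j=1..J. \<Sum>i<2 ^ n. p j i * f j i)"
    unfolding error_prob_classical[OF code ts classical_rcv_public] swap by (simp add: S W_def f_def e_def)
  then have succ: "1 / J * (\<Sum>j=1..J. \<Sum>i<2 ^ n. p j i * f j i) > 9/10" using err[OF ts] by simp
  have "tap_out public_channel ts (E j) = mat_diag (2 ^ n) (\<lambda>i. complex_of_real (p j i))" for j
    unfolding tap_out_def S
    by (subst mixture_words_basis_proj[OF ts, where y = "\<lambda>t a. a"])
      (auto simp: mixture_basis_proj p_def e_def W_def)
  then have hol: "leakage public_channel J E ts =
     holevo (2 ^ n) {1..J} (pmf_of_set {1..J}) (\<lambda>j. mat_diag (2 ^ n) (\<lambda>i. complex_of_real (p j i)))"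
    by (simp add: leakage_def S ts_def)
  have p_sum: "(\<Sum>i<2 ^ n. p j i) = 1" if "j \<in> {1..J}" for j
    using swap[of j "\<lambda>_. 1"] that code fin sum_pmf_eq_1[of W "E j"] by (auto simp: is_code_def S W_def)
  have "4/3 * (1 / J * (\<Sum>j=1..J. \<Sum>i<2 ^ n. p j i * f j i)) - 1/2 - 1 / J \<le>
      ln 2 * leakage public_channel J E ts"
    unfolding hol
  proof (rule holevo_ge_success)
    show "0 \<le> p j i" for j i unfolding p_def by (intro sum_nonneg) auto
    show "0 \<le> f j i" if "i < 2 ^ n" "j \<in> {1..J}" for i j
      using code_diag(1)[OF code] that by (simp add: S f_def)
    show "(\<Sum>j=1..J. f j i) = 1" if "i < 2 ^ n" for i
      using code_diag(2)[OF code] that by (simp add: S f_def)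
  qed (use J p_sum in auto)
  moreover have "1 / real J \<le> 1/2" using J by (simp add: field_simps)
  ultimately have "1/5 < ln 2 * leakage public_channel J E ts" using succ by linarith
  also have "\<dots> \<le> ln 2 * (1/5)" using leak[OF ts] by (intro mult_left_mono) auto
  also have "\<dots> \<le> 1/5" using ln_le_minus_one[of "2::real"] by simp
  finally show False by simp
qed

lemma secrecy_capacity_public: "secrecy_capacity public_channel = 0"
  using zero_rate_achievable[OF is_avcqwc_public classical_rcv_public] public_not_achievable
  by (rule secrecy_capacity_zeroI)

subsection \<open>The product channel\<close>

text \<open>
  The number of keys for which the erasures hide every position in which the two words differ.
\<close>

fun agree_weight :: "'a list \<Rightarrow> 'a list \<Rightarrow> nat" where
  "agree_weight (x # xs) (z # zs) = (if x = z then 2 else 1) * agree_weight xs zs"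
| "agree_weight _ _ = 1"

lemma agree_weight_commute: "agree_weight xs zs = agree_weight zs xs"
  by (induction xs zs rule: agree_weight.induct) auto

text \<open>The sum factorises over positions; each contributes 2 for the agreeing bit and 1 for the
  other. A random word thus has mean weight \<open>(3/2) ^ n\<close>.\<close>

lemma sum_agree_weight:
  "xs \<in> words n {0, 1 :: nat} \<Longrightarrow> (\<Sum>zs\<in>words n {0, 1}. agree_weight xs zs) = 3 ^ n"
proof (induction n arbitrary: xs)
  case 0
  then show ?case by (simp add: words_0)
next
  case (Suc n)
  then obtain x xs' where xs: "xs = x # xs'" "x \<in> {0, 1}" "xs' \<in> words n {0, 1}"
    unfolding words_Suc by auto
  have "(\<Sum>zs\<in>words (Suc n) {0, 1}. agree_weight xs zs) =
     (\<Sum>(z, zs)\<in>{0, 1} \<times> words n {0, 1}. (if x = z then 2 else 1) * agree_weight xs' zs)"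
    unfolding words_Suc xs
    by (subst sum.reindex) (auto simp: inj_on_def intro!: sum.cong)
  also have "\<dots> = (\<Sum>z\<in>{0, 1}. (if x = z then 2 else 1) * 3 ^ n)"
    using Suc.IH[OF xs(3)]
    by (subst sum.cartesian_product[symmetric]) (simp only: sum_distrib_left[symmetric])
  also have "\<dots> = 3 ^ Suc n" using xs(2) by auto
  finally show ?case .
qed

text \<open>
  Greedy choice: the next codeword is one whose total weight to the previous ones is at most
  the average over all words.
\<close>

lemma codebook_exists:
  "\<exists>x. (\<forall>j. x j \<in> words n {0, 1 :: nat}) \<and>
    2 ^ n * (\<Sum>j=1..J. \<Sum>i\<in>{1..J} - {j}. agree_weight (x j) (x i)) \<le> J ^ 2 * 3 ^ n"
proof (induction J)
  case 0
  show ?case by (intro exI[of _ "\<lambda>_. replicate n 0"]) (simp add: replicate_in_words)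
next
  case (Suc J)
  let ?W = "words n {0, 1 :: nat}"
  from Suc obtain x where x: "\<And>j. x j \<in> ?W"
    and b: "2 ^ n * (\<Sum>j=1..J. \<Sum>i\<in>{1..J} - {j}. agree_weight (x j) (x i)) \<le> J ^ 2 * 3 ^ n" by blast
  have W: "finite ?W" "?W \<noteq> {}" "card ?W = 2 ^ n"
    using x by (auto simp: finite_words card_words numeral_2_eq_2)
  \<comment> \<open>Otherwise summing over all \<open>2 ^ n\<close> words would exceed the total
    \<open>J * 3 ^ n\<close> for the sum of weights.\<close>
  have "\<exists>z\<in>?W. 2 ^ n * (\<Sum>j=1..J. agree_weight (x j) z) \<le> J * 3 ^ n"
  proof (rule ccontr)
    assume "\<not> ?thesis"
    then have "(\<Sum>z\<in>?W. J * 3 ^ n) < (\<Sum>z\<in>?W. 2 ^ n * (\<Sum>j=1..J. agree_weight (x j) z))"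
      using W by (intro sum_strict_mono) (auto simp: not_le)
    also have "\<dots> = 2 ^ n * (\<Sum>j=1..J. \<Sum>z\<in>?W. agree_weight (x j) z)"
      by (subst sum.swap) (simp add: sum_distrib_left)
    also have "\<dots> = 2 ^ n * (J * 3 ^ n)" using x by (simp add: sum_agree_weight del: One_nat_def)
    finally show False using W by simp
  qed
  then obtain z where z: "z \<in> ?W" "2 ^ n * (\<Sum>j=1..J. agree_weight (x j) z) \<le> J * 3 ^ n" by blast
  define y where "y = x(Suc J := z)"
  have new: "(\<Sum>i\<in>{1..Suc J} - {Suc J}. agree_weight (y (Suc J)) (y i)) = (\<Sum>j=1..J. agree_weight (x j) z)"
    by (rule sum.cong) (auto simp: y_def agree_weight_commute)
  have old: "(\<Sum>i\<in>{1..Suc J} - {j}. agree_weight (y j) (y i)) =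
      (\<Sum>i\<in>{1..J} - {j}. agree_weight (x j) (x i)) + agree_weight (x j) z" if "j \<in> {1..J}" for j
  proof -
    have "{1..Suc J} - {j} = insert (Suc J) ({1..J} - {j})" using that by auto
    then have "(\<Sum>i\<in>{1..Suc J} - {j}. agree_weight (y j) (y i)) =
       agree_weight (y j) (y (Suc J)) + (\<Sum>i\<in>{1..J} - {j}. agree_weight (y j) (y i))" by simp
    also have "(\<Sum>i\<in>{1..J} - {j}. agree_weight (y j) (y i)) = (\<Sum>i\<in>{1..J} - {j}. agree_weight (x j) (x i))"
      using that by (intro sum.cong) (auto simp: y_def)
    finally show ?thesis using that by (simp add: y_def)
  qed
  have "(\<Sum>j=1..Suc J. \<Sum>i\<in>{1..Suc J} - {j}. agree_weight (y j) (y i)) =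
    (\<Sum>j=1..J. \<Sum>i\<in>{1..Suc J} - {j}. agree_weight (y j) (y i)) + (\<Sum>j=1..J. agree_weight (x j) z)"
    using new by simp
  also have "(\<Sum>j=1..J. \<Sum>i\<in>{1..Suc J} - {j}. agree_weight (y j) (y i)) =
     (\<Sum>j=1..J. \<Sum>i\<in>{1..J} - {j}. agree_weight (x j) (x i)) + (\<Sum>j=1..J. agree_weight (x j) z)"
    using old by (simp add: sum.distrib)
  \<comment> \<open>The new word is counted both as sent word and as competitor, so
    \<open>J * 3 ^ n\<close> enters twice; \<open>J ^ 2 + 2 * J <= (J + 1) ^ 2\<close> preserves the
    quadratic bound.\<close>
  finally have "2 ^ n * (\<Sum>j=1..Suc J. \<Sum>i\<in>{1..Suc J} - {j}. agree_weight (y j) (y i)) \<le>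
      J ^ 2 * 3 ^ n + J * 3 ^ n + J * 3 ^ n"
    using b z(2) by (simp only: distrib_left)
  also have "\<dots> \<le> (Suc J) ^ 2 * 3 ^ n" by (simp add: power2_eq_square algebra_simps)
  finally show ?case using x z(1) by (intro exI[of _ y]) (auto simp: y_def)
qed

section \<open>Masking with a key and the confusions that remain\<close>

definition mask_bit :: "nat \<Rightarrow> nat \<Rightarrow> nat \<times> nat" where
  "mask_bit x k = (if x = k then 0 else 1, k)"

text \<open>The position of the symbol pair \<open>(t + a, k)\<close> in the tensor product of
  dimensions 3 and 2. The second state component is ignored since the public channel has one
  state.\<close>

definition prod_out :: "nat \<times> nat \<Rightarrow> nat \<times> nat \<Rightarrow> nat" where
  "prod_out = (\<lambda>(t, _) (a, k). (t + a) * 2 + k)"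

lemma prod_out_less: "t \<in> {0, 1} \<times> {0} \<Longrightarrow> a \<in> {0, 1} \<times> {0, 1} \<Longrightarrow> prod_out t a < 6"
  by (auto simp: prod_out_def)

text \<open>The keys that spoil the transmission of \<open>xs\<close> under \<open>ts\<close>: the
  receiver, knowing neither key nor state in advance, could explain the output by \<open>zs\<close>
  as well.\<close>

definition confusable :: "nat list \<Rightarrow> nat list \<Rightarrow> (nat \<times> nat) list \<Rightarrow> nat list set" where
  "confusable xs zs ts = {ks \<in> words (length ts) {0, 1}.
     \<exists>us\<in>words (length ts) ({0, 1} \<times> {0}). \<exists>ls\<in>words (length ts) {0, 1}.
       map2 prod_out ts (map2 mask_bit xs ks) = map2 prod_out us (map2 mask_bit zs ls)}"

text \<open>Equal outputs force \<open>k = l\<close>. As \<open>x\<close> and \<open>z\<close>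
  differ, so do their masked bits, and equal sums are then possible only at the ambiguous value 1.
  Hence the masked bit of \<open>x\<close> is the opposite of the state bit, which fixes
  \<open>k\<close>.\<close>

lemma prod_out_mask_eqD:
  assumes "x \<in> {0, 1}" "z \<in> {0, 1}" "k \<in> {0, 1}" "l \<in> {0, 1}" "t \<in> {0, 1} \<times> {0}" "u \<in> {0, 1} \<times> {0}"
    "prod_out t (mask_bit x k) = prod_out u (mask_bit z l)" "x \<noteq> z"
  shows "k = (if fst t = 1 then x else z)"
  using assms by (auto simp: prod_out_def mask_bit_def split: if_splits)

text \<open>Confusion happens position by position: both key bits survive where the words agree, at
  most one where they differ, whatever the state.\<close>

lemma card_confusable:
  assumes "length xs = length zs" "length zs = length ts"
    "set xs \<subseteq> {0, 1}" "set zs \<subseteq> {0, 1}" "set ts \<subseteq> {0, 1} \<times> {0}"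
  shows "card (confusable xs zs ts) \<le> agree_weight xs zs"
  using assms
proof (induction xs zs ts rule: list_induct3)
  case Nil
  have "confusable [] [] [] \<subseteq> {[]}" by (auto simp: confusable_def words_def)
  from card_mono[OF _ this] show ?case by simp
next
  case (Cons x xs z zs t ts)
  define A where "A = {k \<in> {0, 1 :: nat}. x \<noteq> z \<longrightarrow> k = (if fst t = 1 then x else z)}"
  have "confusable (x # xs) (z # zs) (t # ts) \<subseteq> (\<lambda>(k, ks). k # ks) ` (A \<times> confusable xs zs ts)"
  proof
    fix kks assume kks: "kks \<in> confusable (x # xs) (z # zs) (t # ts)"
    then obtain us' ls' where w: "kks \<in> words (Suc (length ts)) {0, 1}"
      "us' \<in> words (Suc (length ts)) ({0, 1} \<times> {0})" "ls' \<in> words (Suc (length ts)) {0, 1}"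
      and eq': "map2 prod_out (t # ts) (map2 mask_bit (x # xs) kks) = map2 prod_out us' (map2 mask_bit (z # zs) ls')"
      unfolding confusable_def length_Cons by blast
    obtain k ks where k: "kks = k # ks" "k \<in> {0, 1}" "ks \<in> words (length ts) {0, 1}"
      using w(1) by (rule words_SucE)
    obtain u us where u: "us' = u # us" "u \<in> {0, 1} \<times> {0}" "us \<in> words (length ts) ({0, 1} \<times> {0})"
      using w(2) by (rule words_SucE)
    obtain l ls where l: "ls' = l # ls" "l \<in> {0, 1}" "ls \<in> words (length ts) {0, 1}"
      using w(3) by (rule words_SucE)
    have eq: "prod_out t (mask_bit x k) = prod_out u (mask_bit z l)"
      "map2 prod_out ts (map2 mask_bit xs ks) = map2 prod_out us (map2 mask_bit zs ls)"
      using eq' by (simp_all add: k(1) u(1) l(1))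
    have "k \<in> A" using prod_out_mask_eqD[of x z k l t u] k u l eq(1) Cons.prems unfolding A_def by auto
    moreover have "ks \<in> confusable xs zs ts" using k u l eq(2) unfolding confusable_def by blast
    ultimately show "kks \<in> (\<lambda>(k, ks). k # ks) ` (A \<times> confusable xs zs ts)" using k(1) by auto
  qed
  moreover have fin: "finite A" "finite (confusable xs zs ts)"
    by (auto simp: A_def confusable_def finite_words)
  ultimately have "card (confusable (x # xs) (z # zs) (t # ts)) \<le> card (A \<times> confusable xs zs ts)"
    by (meson card_image_le card_mono finite_SigmaI finite_imageI le_trans)
  also have "\<dots> = card A * card (confusable xs zs ts)" by (rule card_cartesian_product)
  also have "\<dots> \<le> (if x = z then 2 else 1) * agree_weight xs zs"
  proof (rule mult_mono)
    show "card A \<le> (if x = z then 2 else 1)"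
    proof (cases "x = z")
      case True
      have "card A \<le> card {0, 1 :: nat}" by (rule card_mono) (auto simp: A_def)
      with True show ?thesis by simp
    next
      case False
      then have "card A \<le> card {if fst t = 1 then x else z}" by (intro card_mono) (auto simp: A_def)
      with False show ?thesis by simp
    qed
    show "card (confusable xs zs ts) \<le> agree_weight xs zs" using Cons by simp
  qed auto
  finally show ?case by simp
qed

section \<open>The product as a classical channel, with a random key at the encoder\<close>

lemma avcqwc_prod_add_public:
  "states (avcqwc_prod add_channel public_channel) = {0, 1} \<times> {0}"
  "alphabet (avcqwc_prod add_channel public_channel) = {0, 1} \<times> {0, 1}"
  "dim_rcv (avcqwc_prod add_channel public_channel) = 6"
  "dim_tap (avcqwc_prod add_channel public_channel) = 2"
  "classical_rcv (avcqwc_prod add_channel public_channel) prod_out"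
  "t \<in> {0, 1} \<times> {0} \<Longrightarrow> a \<in> {0, 1} \<times> {0, 1} \<Longrightarrow>
     tap (avcqwc_prod add_channel public_channel) t a = basis_proj 2 (snd a)"
  by (auto simp: avcqwc_prod_def add_channel_def public_channel_def classical_rcv_def prod_out_def
      kron_basis_proj numeral_2_eq_2 numeral_3_eq_3)

definition masked_encoder :: "nat list \<Rightarrow> (nat \<times> nat) list pmf" where
  "masked_encoder xs = map_pmf (map2 mask_bit xs) (pmf_of_set (words (length xs) {0, 1}))"

lemma words_bits: "finite (words n {0, 1 :: nat})" "words n {0, 1 :: nat} \<noteq> {}"
  "card (words n {0, 1 :: nat}) = 2 ^ n"
  using replicate_in_words[of 0 "{0, 1 :: nat}" n] by (auto simp: finite_words card_words numeral_2_eq_2)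

lemma map2_mask_words:
  assumes "xs \<in> words n X" "ks \<in> words n {0, 1}"
  shows "map2 mask_bit xs ks \<in> words n ({0, 1} \<times> {0, 1})"
  using assms by (auto simp: words_def mask_bit_def split: if_splits dest: set_zip_rightD)

lemma set_masked_encoder:
  assumes "xs \<in> words n X" shows "set_pmf (masked_encoder xs) \<subseteq> words n ({0, 1} \<times> {0, 1})"
proof -
  have "length xs = n" using assms by (simp add: words_def)
  then show ?thesis
    using words_bits[of n] map2_mask_words[OF assms] by (auto simp: masked_encoder_def)
qed

lemma sum_masked_encoder:
  assumes "xs \<in> words n X"
  shows "(\<Sum>as\<in>words n ({0, 1} \<times> {0, 1}). pmf (masked_encoder xs) as * g as) =
    (\<Sum>ks\<in>words n {0, 1}. g (map2 mask_bit xs ks)) / 2 ^ n"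
proof -
  have n: "length xs = n" using assms by (simp add: words_def)
  have "(\<Sum>as\<in>words n ({0, 1} \<times> {0, 1}). pmf (masked_encoder xs) as * g as) =
     measure_pmf.expectation (masked_encoder xs) g"
    using set_masked_encoder[OF assms]
    by (subst integral_measure_pmf_real[where A = "words n ({0, 1} \<times> {0, 1})"])
      (auto simp: finite_words mult.commute)
  also have "\<dots> = measure_pmf.expectation (pmf_of_set (words n {0, 1})) (\<lambda>ks. g (map2 mask_bit xs ks))"
    unfolding masked_encoder_def n by simp
  also have "\<dots> = (\<Sum>ks\<in>words n {0, 1}. g (map2 mask_bit xs ks)) / 2 ^ n"
    using words_bits[of n] by (subst integral_pmf_of_set) auto
  finally show ?thesis .
qed

text \<open>The view of the wiretapper is the second component of each input, where
  \<open>mask_bit\<close> places the bare key.\<close>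

lemma map2_snd_mask:
  assumes "length ts = n" "length xs = n" "length ks = n"
  shows "map2 (\<lambda>t a. snd a) ts (map2 mask_bit xs ks) = ks"
  using assms by (intro nth_equalityI) (auto simp: mask_bit_def)

text \<open>Every message gives the wiretapper the same state, the law \<open>\<sigma>\<close> of a
  uniform key, so the leakage is exactly 0.\<close>

lemma masked_leakage:
  assumes x: "\<And>j. x j \<in> words n {0, 1}" and J: "0 < J"
    and ts: "ts \<in> words n ({0, 1} \<times> {0})"
  shows "leakage (avcqwc_prod add_channel public_channel) J (\<lambda>j. masked_encoder (x j)) ts = 0"
proof -
  let ?C = "avcqwc_prod add_channel public_channel"
  define \<sigma> where "\<sigma> = mat_diag (2 ^ n)
    (\<lambda>i. complex_of_real ((\<Sum>ks\<in>words n {0, 1 :: nat}. of_bool (radix 2 ks = i)) / 2 ^ n))"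
  have n: "length ts = n" using ts by (simp add: words_def)
  have "tap_out ?C ts (masked_encoder (x j)) = \<sigma>" for j
  proof -
    have "tap_out ?C ts (masked_encoder (x j)) = mixture (2 ^ n) (words n ({0, 1} \<times> {0, 1}))
        (\<lambda>as. basis_proj (2 ^ n) (radix 2 (map2 (\<lambda>t a. snd a) ts as))) (masked_encoder (x j))"
      unfolding tap_out_def avcqwc_prod_add_public
      by (rule mixture_words_basis_proj[OF ts]) (auto simp: avcqwc_prod_add_public)
    also have "\<dots> = mat_diag (2 ^ n) (\<lambda>i. complex_of_real ((\<Sum>ks\<in>words n {0, 1}.
        of_bool (radix 2 (map2 (\<lambda>t a. snd a) ts (map2 mask_bit (x j) ks)) = i)) / 2 ^ n))"
      unfolding mixture_basis_proj sum_masked_encoder[OF x] ..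
    also have "\<dots> = \<sigma>"
      unfolding \<sigma>_def using n x[of j]
      by (intro arg_cong[of _ _ "mat_diag _"] ext arg_cong[of _ _ complex_of_real]
          arg_cong2[of _ _ _ _ "(/)"] refl sum.cong)
        (subst map2_snd_mask[of ts n "x j"], auto simp: words_def)
    finally show ?thesis .
  qed
  then show ?thesis
    unfolding leakage_def avcqwc_prod_add_public n using J
    by (intro holevo_const[where \<sigma> = \<sigma>]) (auto simp: \<sigma>_def)
qed

text \<open>The decoder names some message that can explain the output. It errs only if a competitor
  explains it too, and the union bound over competitors counts the bad keys among
  \<open>2 ^ n\<close>.\<close>

lemma masked_code:
  assumes x: "\<And>j. x j \<in> words n {0, 1}" and J: "0 < J" and n: "0 < n"
  obtains D where
    "is_code (avcqwc_prod add_channel public_channel) n J (\<lambda>j. masked_encoder (x j)) D"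
    "\<And>ts. ts \<in> words n ({0, 1} \<times> {0}) \<Longrightarrow>
      error_prob (avcqwc_prod add_channel public_channel) J (\<lambda>j. masked_encoder (x j)) D ts
      \<le> 1 / J * ((\<Sum>j=1..J. \<Sum>i\<in>{1..J} - {j}. agree_weight (x j) (x i)) / 2 ^ n)"
proof -
  let ?C = "avcqwc_prod add_channel public_channel"
  let ?S = "{0, 1 :: nat} \<times> {0 :: nat}"
  define out where "out ts j ks = map2 prod_out ts (map2 mask_bit (x j) ks)" for ts j ks
  define consistent where "consistent r j \<longleftrightarrow> j \<in> {1..J} \<and>
    (\<exists>ts\<in>words n ?S. \<exists>ks\<in>words n {0, 1}. r = radix 6 (out ts j ks))" for r j
  \<comment> \<open>The default 1 covers outputs that no message explains, so that the operators
    \<open>D\<close> sum to the identity there too; it is a valid message since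
    \<open>0 < J\<close>.\<close>
  define guess where "guess r = (if \<exists>j. consistent r j then SOME j. consistent r j else 1)" for r
  define D where "D j = mat_diag (6 ^ n) (\<lambda>r. if guess r = j then 1 else 0 :: complex)" for j
  have guess: "consistent r (guess r)" if "consistent r j" for r j
    using that someI[of "consistent r" j] by (auto simp: guess_def)
  have guess_in: "guess r \<in> {1..J}" for r
    using guess[of r] J by (cases "\<exists>j. consistent r j") (auto simp: consistent_def guess_def)
  have sum1: "mat_sum (6 ^ n) D {1..J} = 1\<^sub>m (6 ^ n)"
  proof (rule eq_matI)
    fix r c assume "r < dim_row (1\<^sub>m (6 ^ n) :: complex mat)" "c < dim_col (1\<^sub>m (6 ^ n) :: complex mat)"
    then have rc: "r < 6 ^ n" "c < 6 ^ n" by auto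
    have "(\<Sum>j=1..J. D j $$ (r, c)) = (\<Sum>j=1..J. if guess c = j then of_bool (r = c) else 0)"
      using rc by (intro sum.cong) (auto simp: D_def mat_diag_def)
    also have "\<dots> = of_bool (r = c)" using guess_in[of c] by simp
    finally show "mat_sum (6 ^ n) D {1..J} $$ (r, c) = 1\<^sub>m (6 ^ n) $$ (r, c)"
      using rc by (simp add: mat_sum_def)
  qed (auto simp: mat_sum_def)
  have code: "is_code ?C n J (\<lambda>j. masked_encoder (x j)) D"
    unfolding is_code_def avcqwc_prod_add_public
    using n J sum1 set_masked_encoder[OF x]
    by (auto simp: D_def less_eq_complex_def intro!: pos_semidef_mat_diag)
  show thesis
  proof (rule that[OF code])
    fix ts assume ts: "ts \<in> words n ?S"
    have len: "length ts = n" "\<And>j. length (x j) = n" using ts x by (auto simp: words_def)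
    have out_props: "length (out us j ks) = n" "set (out us j ks) \<subseteq> {..<6}"
      if "us \<in> words n ?S" "ks \<in> words n {0, 1}" for us j ks
    proof -
      have m: "map2 mask_bit (x j) ks \<in> words n ({0, 1} \<times> {0, 1})" by (rule map2_mask_words[OF x that(2)])
      show "length (out us j ks) = n" using that m by (simp add: out_def words_def)
      show "set (out us j ks) \<subseteq> {..<6}"
        unfolding out_def using zip_words[OF that(1) m] prod_out_less by auto
    qed
    have wrong: "(\<Sum>ks\<in>words n {0, 1}. of_bool (guess (radix 6 (out ts j ks)) \<noteq> j)) \<le>
        (\<Sum>i\<in>{1..J} - {j}. real (agree_weight (x j) (x i)))" if j: "j \<in> {1..J}" for j
    proof -
      have "{ks \<in> words n {0, 1}. guess (radix 6 (out ts j ks)) \<noteq> j} \<subseteq>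
          (\<Union>i\<in>{1..J} - {j}. confusable (x j) (x i) ts)"
      proof
        fix ks assume "ks \<in> {ks \<in> words n {0, 1}. guess (radix 6 (out ts j ks)) \<noteq> j}"
        then have ks: "ks \<in> words n {0, 1}" and ne: "guess (radix 6 (out ts j ks)) \<noteq> j" by auto
        let ?i = "guess (radix 6 (out ts j ks))"
        have "consistent (radix 6 (out ts j ks)) j" using j ts ks by (auto simp: consistent_def)
        from guess[OF this] obtain us ls where i: "?i \<in> {1..J}" and us: "us \<in> words n ?S"
          and ls: "ls \<in> words n {0, 1}" and eq: "radix 6 (out ts j ks) = radix 6 (out us ?i ls)"
          unfolding consistent_def by blast
        \<comment> \<open>Positions in the tensor power determine output words.\<close>
        have "out ts j ks = out us ?i ls"
          using eq out_props[OF ts ks] out_props[OF us ls] by (intro radix_inj[of _ _ 6]) auto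
        then have "ks \<in> confusable (x j) (x ?i) ts"
          using ks us ls unfolding confusable_def out_def len by blast
        then show "ks \<in> (\<Union>i\<in>{1..J} - {j}. confusable (x j) (x i) ts)" using i ne by blast
      qed
      then have "card {ks \<in> words n {0, 1}. guess (radix 6 (out ts j ks)) \<noteq> j} \<le>
          card (\<Union>i\<in>{1..J} - {j}. confusable (x j) (x i) ts)"
        by (rule card_mono[rotated]) (auto simp: confusable_def finite_words)
      also have "\<dots> \<le> (\<Sum>i\<in>{1..J} - {j}. card (confusable (x j) (x i) ts))"
        by (rule card_UN_le) simp
      also have "\<dots> \<le> (\<Sum>i\<in>{1..J} - {j}. agree_weight (x j) (x i))"
        using ts x len by (intro sum_mono card_confusable) (auto simp: words_def)
      finally have "real (card {ks \<in> words n {0, 1}. guess (radix 6 (out ts j ks)) \<noteq> j}) \<le>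
         real (\<Sum>i\<in>{1..J} - {j}. agree_weight (x j) (x i))"
        by (rule of_nat_mono)
      then have "real (card {ks \<in> words n {0, 1}. guess (radix 6 (out ts j ks)) \<noteq> j}) \<le>
         (\<Sum>i\<in>{1..J} - {j}. real (agree_weight (x j) (x i)))"
        by (simp only: of_nat_sum)
      moreover have "(\<Sum>ks\<in>words n {0, 1}. of_bool (guess (radix 6 (out ts j ks)) \<noteq> j)) =
          real (card {ks \<in> words n {0, 1}. guess (radix 6 (out ts j ks)) \<noteq> j})"
        using words_bits(1)[of n] by (simp add: sum.If_cases of_bool_def Int_def)
      ultimately show ?thesis by simp
    qed
    have "(\<Sum>as\<in>words n ({0, 1} \<times> {0, 1}). pmf (masked_encoder (x j)) as *
        Re (D j $$ (radix 6 (map2 prod_out ts as), radix 6 (map2 prod_out ts as)))) =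
      1 - (\<Sum>ks\<in>words n {0, 1}. of_bool (guess (radix 6 (out ts j ks)) \<noteq> j)) / 2 ^ n" for j
    proof -
      have "(\<Sum>as\<in>words n ({0, 1} \<times> {0, 1}). pmf (masked_encoder (x j)) as *
          Re (D j $$ (radix 6 (map2 prod_out ts as), radix 6 (map2 prod_out ts as)))) =
        (\<Sum>ks\<in>words n {0, 1}. Re (D j $$ (radix 6 (out ts j ks), radix 6 (out ts j ks)))) / 2 ^ n"
        unfolding sum_masked_encoder[OF x] out_def ..
      also have "(\<Sum>ks\<in>words n {0, 1}. Re (D j $$ (radix 6 (out ts j ks), radix 6 (out ts j ks)))) =
        (\<Sum>ks\<in>words n {0, 1}. 1 - of_bool (guess (radix 6 (out ts j ks)) \<noteq> j))"
      proof (rule sum.cong)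
        fix ks assume "ks \<in> words n {0, 1 :: nat}"
        then have "radix 6 (out ts j ks) < 6 ^ n" using out_props[OF ts] radix_less by metis
        then show "Re (D j $$ (radix 6 (out ts j ks), radix 6 (out ts j ks))) =
            1 - of_bool (guess (radix 6 (out ts j ks)) \<noteq> j)"
          by (simp add: D_def mat_diag_def)
      qed simp
      also have "\<dots> = 2 ^ n - (\<Sum>ks\<in>words n {0, 1}. of_bool (guess (radix 6 (out ts j ks)) \<noteq> j))"
        unfolding sum_subtractf using words_bits(3)[of n] by simp
      finally show ?thesis by (simp add: diff_divide_distrib)
    qed
    then have "error_prob ?C J (\<lambda>j. masked_encoder (x j)) D ts = 1 - 1 / J *
        (\<Sum>j=1..J. 1 - (\<Sum>ks\<in>words n {0, 1}. of_bool (guess (radix 6 (out ts j ks)) \<noteq> j)) / 2 ^ n)"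
      using error_prob_classical[OF code _ avcqwc_prod_add_public(5), of ts] ts
      by (simp add: avcqwc_prod_add_public)
    also have "\<dots> = 1 / J * (\<Sum>j=1..J. (\<Sum>ks\<in>words n {0, 1}.
        of_bool (guess (radix 6 (out ts j ks)) \<noteq> j)) / 2 ^ n)"
      unfolding sum_subtractf using J by (simp add: right_diff_distrib)
    also have "\<dots> \<le> 1 / J * (\<Sum>j=1..J. (\<Sum>i\<in>{1..J} - {j}. real (agree_weight (x j) (x i))) / 2 ^ n)"
      using wrong by (intro mult_left_mono sum_mono divide_right_mono) auto
    finally show "error_prob ?C J (\<lambda>j. masked_encoder (x j)) D ts
      \<le> 1 / J * ((\<Sum>j=1..J. \<Sum>i\<in>{1..J} - {j}. agree_weight (x j) (x i)) / 2 ^ n)"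
      by (simp add: sum_divide_distrib)
  qed
qed

section \<open>A positive rate for the product\<close>

lemma prod_code_exists:
  assumes "0 < J" "0 < n"
  obtains E D where "is_code (avcqwc_prod add_channel public_channel) n J E D"
    "\<And>ts. ts \<in> words n ({0, 1} \<times> {0}) \<Longrightarrow>
      error_prob (avcqwc_prod add_channel public_channel) J E D ts \<le> J * (3/4) ^ n"
    "\<And>ts. ts \<in> words n ({0, 1} \<times> {0}) \<Longrightarrow>
      leakage (avcqwc_prod add_channel public_channel) J E ts = 0"
proof -
  let ?C = "avcqwc_prod add_channel public_channel"
  obtain x where x: "\<And>j. x j \<in> words n {0, 1 :: nat}"
    and b: "2 ^ n * (\<Sum>j=1..J. \<Sum>i\<in>{1..J} - {j}. agree_weight (x j) (x i)) \<le> J ^ 2 * 3 ^ n"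
    (is "2 ^ n * ?s \<le> _")
    using codebook_exists[of n J] by blast
  obtain D where D: "is_code ?C n J (\<lambda>j. masked_encoder (x j)) D"
    "\<And>ts. ts \<in> words n ({0, 1} \<times> {0}) \<Longrightarrow>
      error_prob ?C J (\<lambda>j. masked_encoder (x j)) D ts \<le> 1 / J * (?s / 2 ^ n)"
    using masked_code[of x n J] x assms by blast
  have "real (2 ^ n * ?s) \<le> real (J ^ 2 * 3 ^ n)" using b by (simp only: of_nat_le_iff)
  then have "2 ^ n * real ?s \<le> J ^ 2 * 3 ^ n" by simp
  \<comment> \<open>One factor \<open>2 ^ n\<close> stems from averaging over codewords, the other
    from averaging over keys; together they turn \<open>3 ^ n\<close> into
    \<open>(3/4) ^ n\<close>.\<close>
  then have "real ?s / 2 ^ n \<le> J ^ 2 * 3 ^ n / 2 ^ n / 2 ^ n" by (simp add: field_simps)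
  then have "1 / J * (real ?s / 2 ^ n) \<le> 1 / J * (J ^ 2 * 3 ^ n / 2 ^ n / 2 ^ n)"
    by (rule mult_left_mono) simp
  also have "\<dots> = J * (3 ^ n / (2 ^ n * 2 ^ n))" using assms by (simp add: power2_eq_square)
  also have "(3 :: real) ^ n / (2 ^ n * 2 ^ n) = (3/4) ^ n"
    by (simp add: power_divide flip: power_mult_distrib)
  finally have "1 / J * (real ?s / 2 ^ n) \<le> J * (3/4) ^ n" .
  with D(2) have "error_prob ?C J (\<lambda>j. masked_encoder (x j)) D ts \<le> J * (3/4) ^ n"
    if "ts \<in> words n ({0, 1} \<times> {0})" for ts
    using that by (meson order_trans)
  then show thesis using masked_leakage[OF x assms(1)] by (rule that[OF D(1)])
qed

lemma prod_achievable: "achievable_secrecy_rate (avcqwc_prod add_channel public_channel) (1/4)"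
  unfolding achievable_secrecy_rate_def
proof (intro conjI allI impI)
  let ?C = "avcqwc_prod add_channel public_channel"
  fix \<epsilon> \<delta> \<zeta> :: real assume pos: "\<epsilon> > 0" "\<delta> > 0" "\<zeta> > 0"
  \<comment> \<open>At rate 1/4 the error bound \<open>J * (3/4) ^ n\<close> is compared with
    \<open>\<epsilon>\<close> through fourth powers, which avoids roots:
    \<open>2 * (3/4) ^ 4 = 81/128 < 1\<close>.\<close>
  have "(\<lambda>n. (81/128 :: real) ^ n) \<longlonglongrightarrow> 0" by (rule LIMSEQ_realpow_zero) auto
  then have "\<forall>\<^sub>F n in sequentially. (81/128 :: real) ^ n < \<epsilon> ^ 4"
    by (rule order_tendstoD) (use pos in simp)
  moreover have "\<forall>\<^sub>F n in sequentially. 1 / \<delta> < real n"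
    using filterlim_real_sequentially by (rule filterlim_at_top_dense[THEN iffD1, rule_format])
  ultimately show "\<forall>\<^sub>F n in sequentially. \<exists>J E D. is_code ?C n J E D \<and>
          log 2 (real J) / real n > 1/4 - \<delta> \<and>
          (MAX ts \<in> words n (states ?C). error_prob ?C J E D ts) < \<epsilon> \<and>
          (MAX ts \<in> words n (states ?C). leakage ?C J E ts) < \<zeta>"
    using eventually_gt_at_top[of 0]
  proof eventually_elim
    case (elim n)
    define J :: nat where "J = 2 ^ (n div 4)"
    obtain E D where code: "is_code ?C n J E D"
      and err: "\<And>ts. ts \<in> words n ({0, 1} \<times> {0}) \<Longrightarrow> error_prob ?C J E D ts \<le> J * (3/4) ^ n"
      and leak: "\<And>ts. ts \<in> words n ({0, 1} \<times> {0}) \<Longrightarrow> leakage ?C J E ts = 0"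
      using prod_code_exists[of J n] elim by (auto simp: J_def)
    have "((3/4 :: real) ^ n) ^ 4 = ((3/4) ^ 4) ^ n"
      by (simp only: power_mult[symmetric] mult.commute)
    also have "(3/4 :: real) ^ 4 = 81/256" by (simp add: power_divide)
    finally have "((3/4 :: real) ^ n) ^ 4 = (81/256) ^ n" .
    then have "(J * (3/4) ^ n) ^ 4 = real 2 ^ (n div 4 * 4) * (81/256) ^ n"
      by (simp add: J_def power_mult_distrib power_mult)
    also have "\<dots> \<le> 2 ^ n * (81/256) ^ n"
      by (intro mult_right_mono) (auto intro: power_increasing)
    also have "\<dots> = (81/128) ^ n" by (simp flip: power_mult_distrib)
    also have "\<dots> < \<epsilon> ^ 4" by (fact elim)
    finally have small: "J * (3/4) ^ n < \<epsilon>" by (rule power_less_imp_less_base) (use pos in simp)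
    have w: "finite (words n ({0, 1 :: nat} \<times> {0 :: nat}))" "words n ({0, 1 :: nat} \<times> {0 :: nat}) \<noteq> {}"
      using replicate_in_words[of "(0, 0)" "{0, 1 :: nat} \<times> {0 :: nat}" n] by (auto simp: finite_words)
    \<comment> \<open>Rounding \<open>n / 4\<close> down costs at most 3/4, which is covered by
      \<open>\<delta> * n > 1\<close>.\<close>
    have "real n \<le> 4 * real (n div 4) + 3" by linarith
    moreover have "1 < \<delta> * n" using elim pos by (simp add: field_simps)
    ultimately have "(1/4 - \<delta>) * n < real (n div 4)" by (simp add: algebra_simps)
    then have "1/4 - \<delta> < real (n div 4) / n" using elim by (simp add: pos_less_divide_eq)
    moreover have "log 2 (real J) = real (n div 4)" by (simp add: J_def log_nat_power)
    moreover have "error_prob ?C J E D ts < \<epsilon>" if "ts \<in> words n ({0, 1} \<times> {0})" for ts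
      using err[OF that] small by linarith
    ultimately show ?case
      using code leak w pos unfolding avcqwc_prod_add_public
      by (intro exI[of _ J] exI[of _ E] exI[of _ D]) auto
  qed
qed simp

theorem theorem5p2:
  shows "\<exists>(C :: (nat, nat) avcqwc) (C' :: (nat, nat) avcqwc).
    is_avcqwc C \<and> is_avcqwc C' \<and>
    secrecy_capacity C = 0 \<and> secrecy_capacity C' = 0 \<and>
    secrecy_capacity (avcqwc_prod C C') > 0"
proof (intro exI conjI)
  have "ereal (1/4) \<le> secrecy_capacity (avcqwc_prod add_channel public_channel)"
    unfolding secrecy_capacity_def using prod_achievable by (intro Sup_upper) auto
  moreover have "(0 :: ereal) < ereal (1/4)" by simp
  ultimately show "0 < secrecy_capacity (avcqwc_prod add_channel public_channel)"
    by (rule less_le_trans[rotated])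
qed (rule is_avcqwc_add is_avcqwc_public secrecy_capacity_add secrecy_capacity_public)+

end
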